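(* Let $R$ be a ring that is projectively graded by a locally finite group $G$. Then $R$ has UGN if and only if $R_1$ has UGN.
   Context: Rings are unital; "module" means right module unless stated otherwise. A ring $S$ has unbounded generating number (UGN) if, for every positive integer $n$, there is no $S$-module epimorphism $S^n\to S^{n+1}$. A ring $R$ is graded by a group $G$ if there are additive subgroups $R_g$ ($g\in G$) with $R=\bigoplus_{g\in G}R_g$ as additive groups and $R_gR_h\subseteq R_{gh}$ for all $g,h\in G$; $R_1$ is the subring that is the component of the identity of $G$. The grading is projective ($R$ is projectively graded) if either all the $R_g$ are finitely generated projective right $R_1$-modules, or all the $R_g$ are finitely generated projective left $R_1$-modules. A group is locally finite if all its finitely generated subgroups are finite. *)

theory Defs
  imports "HOL-Algebra.Module" "HOL-Algebra.Subrings" "HOL-Algebra.Generated_Groups"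
begin

section \<open>Right and left modules over a ring\<close>

text \<open>
  The locale \<open>module\<close> of HOL-Algebra requires a commutative base ring.  Its record type is reused
  here for right modules over arbitrary unital rings: \<open>a \<odot>\<^bsub>M\<^esub> x\<close> stands for the right action
  \<open>x \<cdot> a\<close>, whence the order of the factors in \<open>smult_assoc\<close>.  The fields \<open>mult\<close> and \<open>one\<close> of a
  module record carry no meaning.  A ring may be the zero ring.
\<close>

locale right_module = S?: ring S + M?: abelian_group M
  for S :: "('a, 's) ring_scheme" (structure) and M :: "('a, 'b, 'm) module_scheme" (structure) +
  assumes smult_closed [simp, intro]:
      "\<lbrakk>a \<in> carrier S; x \<in> carrier M\<rbrakk> \<Longrightarrow> a \<odot>\<^bsub>M\<^esub> x \<in> carrier M"
    and smult_l_distr: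
      "\<lbrakk>a \<in> carrier S; b \<in> carrier S; x \<in> carrier M\<rbrakk> \<Longrightarrow>
        (a \<oplus>\<^bsub>S\<^esub> b) \<odot>\<^bsub>M\<^esub> x = a \<odot>\<^bsub>M\<^esub> x \<oplus>\<^bsub>M\<^esub> b \<odot>\<^bsub>M\<^esub> x"
    and smult_r_distr:
      "\<lbrakk>a \<in> carrier S; x \<in> carrier M; y \<in> carrier M\<rbrakk> \<Longrightarrow>
        a \<odot>\<^bsub>M\<^esub> (x \<oplus>\<^bsub>M\<^esub> y) = a \<odot>\<^bsub>M\<^esub> x \<oplus>\<^bsub>M\<^esub> a \<odot>\<^bsub>M\<^esub> y"
    and smult_assoc:
      "\<lbrakk>a \<in> carrier S; b \<in> carrier S; x \<in> carrier M\<rbrakk> \<Longrightarrow>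
        (a \<otimes>\<^bsub>S\<^esub> b) \<odot>\<^bsub>M\<^esub> x = b \<odot>\<^bsub>M\<^esub> (a \<odot>\<^bsub>M\<^esub> x)"
    and smult_one [simp]:
      "x \<in> carrier M \<Longrightarrow> \<one>\<^bsub>S\<^esub> \<odot>\<^bsub>M\<^esub> x = x"

text \<open>A left \<open>S\<close>-module is a right module over \<open>opposite_ring S\<close>.\<close>

definition opposite_ring :: "('a, 'm) ring_scheme \<Rightarrow> ('a, 'm) ring_scheme"
  where "opposite_ring S = S\<lparr>mult := (\<lambda>x y. y \<otimes>\<^bsub>S\<^esub> x)\<rparr>"

definition mod_hom ::
  "('a, 's) ring_scheme \<Rightarrow> ('a, 'b, 'm) module_scheme \<Rightarrow> ('a, 'c, 'n) module_scheme \<Rightarrow> ('b \<Rightarrow> 'c) set"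
  where "mod_hom S M N = {h \<in> hom (add_monoid M) (add_monoid N).
    \<forall>a\<in>carrier S. \<forall>x\<in>carrier M. h (a \<odot>\<^bsub>M\<^esub> x) = a \<odot>\<^bsub>N\<^esub> h x}"

definition mod_epi ::
  "('a, 's) ring_scheme \<Rightarrow> ('a, 'b, 'm) module_scheme \<Rightarrow> ('a, 'c, 'n) module_scheme \<Rightarrow> ('b \<Rightarrow> 'c) set"
  where "mod_epi S M N = {h \<in> mod_hom S M N. h ` carrier M = carrier N}"

text \<open>The free right module \<open>S\<^sup>(\<^sup>I\<^sup>)\<close> of finitely supported families; for finite \<open>I\<close> the condition
  on the support is void.\<close>

definition free_module :: "('a, 's) ring_scheme \<Rightarrow> 'i set \<Rightarrow> ('a, 'i \<Rightarrow> 'a) module"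
  where "free_module S I =
    \<lparr>carrier = {v \<in> I \<rightarrow>\<^sub>E carrier S. finite {i \<in> I. v i \<noteq> \<zero>\<^bsub>S\<^esub>}},
     mult = undefined, one = undefined,
     zero = (\<lambda>i\<in>I. \<zero>\<^bsub>S\<^esub>),
     add = (\<lambda>v w. \<lambda>i\<in>I. v i \<oplus>\<^bsub>S\<^esub> w i),
     smult = (\<lambda>a v. \<lambda>i\<in>I. v i \<otimes>\<^bsub>S\<^esub> a)\<rparr>"

abbreviation free_module_rank :: "('a, 's) ring_scheme \<Rightarrow> nat \<Rightarrow> ('a, nat \<Rightarrow> 'a) module"
  where "free_module_rank S n \<equiv> free_module S {..<n}"

definition UGN :: "('a, 's) ring_scheme \<Rightarrow> bool"
  where "UGN S \<longleftrightarrow>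
    (\<forall>n>0. \<not> (\<exists>h. h \<in> mod_epi S (free_module_rank S n) (free_module_rank S (n + 1))))"


section \<open>Finitely generated projective modules\<close>

definition fin_gen_module :: "('a, 's) ring_scheme \<Rightarrow> ('a, 'b, 'm) module_scheme \<Rightarrow> bool"
  where "fin_gen_module S M \<longleftrightarrow>
    (\<exists>X. finite X \<and> X \<subseteq> carrier M \<and> (\<forall>H. submodule H S M \<and> X \<subseteq> H \<longrightarrow> H = carrier M))"

text \<open>
  Projectivity is the lifting property against all epimorphisms \<open>N \<rightarrow> N'\<close>.  A formula
  cannot quantify over types, so \<open>N\<close> and \<open>N'\<close> range over the modules on the two fixed types
  \<open>'b \<Rightarrow> 'a\<close> and \<open>'b\<close>; the lemma \<open>projective_module_lift\<close> below shows that this implies the lifting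
  property for modules on arbitrary types.
\<close>

definition projective_module :: "('a, 's) ring_scheme \<Rightarrow> ('a, 'b) module \<Rightarrow> bool"
  where "projective_module S M \<longleftrightarrow> right_module S M \<and>
    (\<forall>(N :: ('a, 'b \<Rightarrow> 'a) module) (N' :: ('a, 'b) module) p f.
       right_module S N \<longrightarrow> right_module S N' \<longrightarrow> p \<in> mod_epi S N N' \<longrightarrow> f \<in> mod_hom S M N' \<longrightarrow>
       (\<exists>h\<in>mod_hom S M N. \<forall>x\<in>carrier M. p (h x) = f x))"


section \<open>Group gradings\<close>

locale graded_ring = R?: ring R + G?: group G
  for R :: "('a, 'm) ring_scheme" and G :: "('g, 'k) monoid_scheme" +
  fixes A :: "'g \<Rightarrow> 'a set"
  assumes component_subgroup: "g \<in> carrier G \<Longrightarrow> additive_subgroup (A g) R"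
    and direct_sum: "x \<in> carrier R \<Longrightarrow>
      \<exists>!f. f \<in> (\<Pi>\<^sub>E g\<in>carrier G. A g) \<and> finite {g \<in> carrier G. f g \<noteq> \<zero>\<^bsub>R\<^esub>} \<and>
           x = (\<Oplus>\<^bsub>R\<^esub>g\<in>{g \<in> carrier G. f g \<noteq> \<zero>\<^bsub>R\<^esub>}. f g)"
    and component_mult: "\<lbrakk>g \<in> carrier G; h \<in> carrier G; x \<in> A g; y \<in> A h\<rbrakk> \<Longrightarrow>
      x \<otimes>\<^bsub>R\<^esub> y \<in> A (g \<otimes>\<^bsub>G\<^esub> h)"

text \<open>The base ring \<open>R\<^sub>1\<close>; see \<open>base_subring\<close> below for the fact that \<open>A \<one>\<^bsub>G\<^esub>\<close> contains \<open>\<one>\<^bsub>R\<^esub>\<close>.\<close>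

definition base_ring ::
  "('a, 'm) ring_scheme \<Rightarrow> ('g, 'k) monoid_scheme \<Rightarrow> ('g \<Rightarrow> 'a set) \<Rightarrow> ('a, 'm) ring_scheme"
  where "base_ring R G A = R\<lparr>carrier := A \<one>\<^bsub>G\<^esub>\<rparr>"

definition right_mult_module :: "('a, 'm) ring_scheme \<Rightarrow> 'a set \<Rightarrow> ('a, 'a) module"
  where "right_mult_module R B =
    \<lparr>carrier = B, mult = undefined, one = undefined, zero = \<zero>\<^bsub>R\<^esub>, add = (\<oplus>\<^bsub>R\<^esub>),
     smult = (\<lambda>a x. x \<otimes>\<^bsub>R\<^esub> a)\<rparr>"

definition left_mult_module :: "('a, 'm) ring_scheme \<Rightarrow> 'a set \<Rightarrow> ('a, 'a) module"
  where "left_mult_module R B =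
    \<lparr>carrier = B, mult = undefined, one = undefined, zero = \<zero>\<^bsub>R\<^esub>, add = (\<oplus>\<^bsub>R\<^esub>),
     smult = (\<lambda>a x. a \<otimes>\<^bsub>R\<^esub> x)\<rparr>"

definition projective_grading ::
  "('a, 'm) ring_scheme \<Rightarrow> ('g, 'k) monoid_scheme \<Rightarrow> ('g \<Rightarrow> 'a set) \<Rightarrow> bool"
  where "projective_grading R G A \<longleftrightarrow>
    (\<forall>g\<in>carrier G.
       fin_gen_module (base_ring R G A) (right_mult_module R (A g)) \<and>
       projective_module (base_ring R G A) (right_mult_module R (A g))) \<or>
    (\<forall>g\<in>carrier G.
       fin_gen_module (opposite_ring (base_ring R G A)) (left_mult_module R (A g)) \<and>
       projective_module (opposite_ring (base_ring R G A)) (left_mult_module R (A g)))"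

definition locally_finite_group :: "('g, 'k) monoid_scheme \<Rightarrow> bool"
  where "locally_finite_group G \<longleftrightarrow> group G \<and>
    (\<forall>X. finite X \<and> X \<subseteq> carrier G \<longrightarrow> finite (generate G X))"


section \<open>Consistency of the definitions\<close>

subsection \<open>The base ring and the components\<close>

context graded_ring
begin

lemma component_carrier: "g \<in> carrier G \<Longrightarrow> x \<in> A g \<Longrightarrow> x \<in> carrier R"
  by (rule additive_subgroup.a_Hcarr[OF component_subgroup])

lemma component_zero: "g \<in> carrier G \<Longrightarrow> \<zero>\<^bsub>R\<^esub> \<in> A g"
  by (rule additive_subgroup.zero_closed[OF component_subgroup])

lemma family_unique:
  assumes f: "f \<in> (\<Pi>\<^sub>E g\<in>carrier G. A g)" "finite {g \<in> carrier G. f g \<noteq> \<zero>\<^bsub>R\<^esub>}"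
    and f': "f' \<in> (\<Pi>\<^sub>E g\<in>carrier G. A g)" "finite {g \<in> carrier G. f' g \<noteq> \<zero>\<^bsub>R\<^esub>}"
    and eq: "(\<Oplus>\<^bsub>R\<^esub>g\<in>{g \<in> carrier G. f g \<noteq> \<zero>\<^bsub>R\<^esub>}. f g) =
             (\<Oplus>\<^bsub>R\<^esub>g\<in>{g \<in> carrier G. f' g \<noteq> \<zero>\<^bsub>R\<^esub>}. f' g)"
  shows "f = f'"
proof -
  let ?x = "\<Oplus>\<^bsub>R\<^esub>g\<in>{g \<in> carrier G. f g \<noteq> \<zero>\<^bsub>R\<^esub>}. f g"
  have "?x \<in> carrier R"
    using f by (intro R.finsum_closed) (auto simp: PiE_iff intro: component_carrier)
  from direct_sum[OF this] obtain z where z: "\<And>y. y \<in> (\<Pi>\<^sub>E g\<in>carrier G. A g) \<Longrightarrow>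
      finite {g \<in> carrier G. y g \<noteq> \<zero>\<^bsub>R\<^esub>} \<Longrightarrow>
      ?x = (\<Oplus>\<^bsub>R\<^esub>g\<in>{g \<in> carrier G. y g \<noteq> \<zero>\<^bsub>R\<^esub>}. y g) \<Longrightarrow> y = z"
    by (elim ex1E) (rule that, erule allE, erule mp, intro conjI)
  show ?thesis using z[OF f refl] z[OF f' eq] by simp
qed

lemma one_in_base: "\<one>\<^bsub>R\<^esub> \<in> A \<one>\<^bsub>G\<^esub>"
proof -
  obtain e where e: "e \<in> (\<Pi>\<^sub>E g\<in>carrier G. A g)" "finite {g \<in> carrier G. e g \<noteq> \<zero>\<^bsub>R\<^esub>}"
    "\<one>\<^bsub>R\<^esub> = (\<Oplus>\<^bsub>R\<^esub>g\<in>{g \<in> carrier G. e g \<noteq> \<zero>\<^bsub>R\<^esub>}. e g)"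
    using ex1_implies_ex[OF direct_sum[OF R.one_closed]] by (elim exE conjE) (rule that)
  let ?E = "{g \<in> carrier G. e g \<noteq> \<zero>\<^bsub>R\<^esub>}"
  have eA: "e g \<in> A g" "e g \<in> carrier R" if "g \<in> carrier G" for g
    using e(1) that component_carrier by (auto simp: PiE_iff)
  have hom: "r \<otimes>\<^bsub>R\<^esub> e \<one>\<^bsub>G\<^esub> = r" if h: "h \<in> carrier G" and r: "r \<in> A h" for h r
  proof -
    have rc: "r \<in> carrier R" using component_carrier h r by blast
    define f where "f = (\<lambda>k\<in>carrier G. r \<otimes>\<^bsub>R\<^esub> e (inv\<^bsub>G\<^esub> h \<otimes>\<^bsub>G\<^esub> k))"
    define d where "d = (\<lambda>k\<in>carrier G. if k = h then r else \<zero>\<^bsub>R\<^esub>)"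
    have fA: "f k \<in> A k" if k: "k \<in> carrier G" for k
    proof -
      have "r \<otimes>\<^bsub>R\<^esub> e (inv\<^bsub>G\<^esub> h \<otimes>\<^bsub>G\<^esub> k) \<in> A (h \<otimes>\<^bsub>G\<^esub> (inv\<^bsub>G\<^esub> h \<otimes>\<^bsub>G\<^esub> k))"
        using h k r eA by (intro component_mult) auto
      also have "h \<otimes>\<^bsub>G\<^esub> (inv\<^bsub>G\<^esub> h \<otimes>\<^bsub>G\<^esub> k) = k"
        using h k by (metis G.inv_closed G.m_assoc G.r_inv G.l_one)
      finally show ?thesis using k by (simp add: f_def)
    qed
    have f1: "f \<in> (\<Pi>\<^sub>E g\<in>carrier G. A g)"
      using fA by (auto simp: PiE_iff f_def extensional_def)
    have sub: "{k \<in> carrier G. f k \<noteq> \<zero>\<^bsub>R\<^esub>} \<subseteq> (\<lambda>g. h \<otimes>\<^bsub>G\<^esub> g) ` ?E"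
    proof
      fix k assume "k \<in> {k \<in> carrier G. f k \<noteq> \<zero>\<^bsub>R\<^esub>}"
      then have k: "k \<in> carrier G" "e (inv\<^bsub>G\<^esub> h \<otimes>\<^bsub>G\<^esub> k) \<noteq> \<zero>\<^bsub>R\<^esub>"
        using rc by (auto simp: f_def)
      have "k = h \<otimes>\<^bsub>G\<^esub> (inv\<^bsub>G\<^esub> h \<otimes>\<^bsub>G\<^esub> k)"
        using h k by (metis G.inv_closed G.m_assoc G.r_inv G.l_one)
      then show "k \<in> (\<lambda>g. h \<otimes>\<^bsub>G\<^esub> g) ` ?E" using h k by blast
    qed
    have f2: "finite {k \<in> carrier G. f k \<noteq> \<zero>\<^bsub>R\<^esub>}"
      using sub e(2) finite_subset by blast
    have inj: "inj_on (\<lambda>g. h \<otimes>\<^bsub>G\<^esub> g) ?E"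
      using h by (auto intro!: inj_onI)
    have "r = r \<otimes>\<^bsub>R\<^esub> (\<Oplus>\<^bsub>R\<^esub>g\<in>?E. e g)" using rc by (simp add: e(3)[symmetric])
    also have "\<dots> = (\<Oplus>\<^bsub>R\<^esub>g\<in>?E. r \<otimes>\<^bsub>R\<^esub> e g)"
      using e(2) rc eA by (intro R.finsum_rdistr) auto
    also have "\<dots> = (\<Oplus>\<^bsub>R\<^esub>g\<in>?E. f (h \<otimes>\<^bsub>G\<^esub> g))"
      using h rc eA by (intro R.finsum_cong') (auto simp: f_def G.m_assoc[symmetric])
    also have "\<dots> = (\<Oplus>\<^bsub>R\<^esub>k\<in>(\<lambda>g. h \<otimes>\<^bsub>G\<^esub> g) ` ?E. f k)"
      using inj h component_carrier[OF _ fA]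
      by (intro R.finsum_reindex[symmetric]) auto
    also have "\<dots> = (\<Oplus>\<^bsub>R\<^esub>k\<in>{k \<in> carrier G. f k \<noteq> \<zero>\<^bsub>R\<^esub>}. f k)"
      using sub e(2) h component_carrier[OF _ fA]
      by (intro R.add.finprod_mono_neutral_cong_right) auto
    finally have fr: "r = (\<Oplus>\<^bsub>R\<^esub>k\<in>{k \<in> carrier G. f k \<noteq> \<zero>\<^bsub>R\<^esub>}. f k)" .
    have d1: "d \<in> (\<Pi>\<^sub>E g\<in>carrier G. A g)"
      using r component_zero by (auto simp: PiE_iff d_def extensional_def)
    have d2: "finite {k \<in> carrier G. d k \<noteq> \<zero>\<^bsub>R\<^esub>}"
      by (rule finite_subset[of _ "{h}"]) (auto simp: d_def)
    have "(\<Oplus>\<^bsub>R\<^esub>k\<in>{k \<in> carrier G. d k \<noteq> \<zero>\<^bsub>R\<^esub>}. d k) = (\<Oplus>\<^bsub>R\<^esub>k\<in>{h}. d k)"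
      using h rc by (intro R.add.finprod_mono_neutral_cong_left) (auto simp: d_def)
    also have "\<dots> = r" using h rc by (simp add: d_def)
    finally have "f = d" using fr f1 f2 d1 d2 by (intro family_unique) auto
    then have "f h = d h" by simp
    then show ?thesis using h by (simp add: f_def d_def)
  qed
  have "\<one>\<^bsub>R\<^esub> \<otimes>\<^bsub>R\<^esub> e \<one>\<^bsub>G\<^esub> = (\<Oplus>\<^bsub>R\<^esub>g\<in>?E. e g) \<otimes>\<^bsub>R\<^esub> e \<one>\<^bsub>G\<^esub>" by (simp only: e(3)[symmetric])
  also have "\<dots> = (\<Oplus>\<^bsub>R\<^esub>g\<in>?E. e g \<otimes>\<^bsub>R\<^esub> e \<one>\<^bsub>G\<^esub>)"
    using e(2) eA by (intro R.finsum_ldistr) auto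
  also have "\<dots> = (\<Oplus>\<^bsub>R\<^esub>g\<in>?E. e g)"
    using hom eA by (intro R.finsum_cong') auto
  also note e(3)[symmetric]
  finally have "e \<one>\<^bsub>G\<^esub> = \<one>\<^bsub>R\<^esub>" using eA by simp
  then show ?thesis using eA(1)[of "\<one>\<^bsub>G\<^esub>"] by simp
qed

lemma base_subring: "subring (A \<one>\<^bsub>G\<^esub>) R"
proof (rule R.subringI)
  show "A \<one>\<^bsub>G\<^esub> \<subseteq> carrier R" using component_carrier by blast
  show "\<one>\<^bsub>R\<^esub> \<in> A \<one>\<^bsub>G\<^esub>" by (rule one_in_base)
  interpret B: additive_subgroup "A \<one>\<^bsub>G\<^esub>" R by (rule component_subgroup) simp
  show "\<ominus>\<^bsub>R\<^esub> x \<in> A \<one>\<^bsub>G\<^esub>" if "x \<in> A \<one>\<^bsub>G\<^esub>" for x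
    using subgroup.m_inv_closed[OF B.a_subgroup] that by (simp add: a_inv_def)
  show "x \<oplus>\<^bsub>R\<^esub> y \<in> A \<one>\<^bsub>G\<^esub>" if "x \<in> A \<one>\<^bsub>G\<^esub>" "y \<in> A \<one>\<^bsub>G\<^esub>" for x y
    using that by (rule B.a_closed)
  show "x \<otimes>\<^bsub>R\<^esub> y \<in> A \<one>\<^bsub>G\<^esub>" if "x \<in> A \<one>\<^bsub>G\<^esub>" "y \<in> A \<one>\<^bsub>G\<^esub>" for x y
    using component_mult[OF _ _ that] by simp
qed

lemma base_ring_ring: "ring (base_ring R G A)"
  unfolding base_ring_def by (rule R.subring_is_ring[OF base_subring])

lemma opposite_base_ring_ring: "ring (opposite_ring (base_ring R G A))"
proof -
  interpret B: ring "base_ring R G A" by (rule base_ring_ring)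
  show ?thesis
    by (rule ringI, rule abelian_groupI)
      (auto simp: opposite_ring_def B.a_ac B.m_assoc B.l_distr B.r_distr
        intro: B.l_neg B.a_inv_closed intro!: monoidI bexI[of _ "\<ominus>\<^bsub>base_ring R G A\<^esub> _"])
qed

lemma component_abelian_group:
  assumes g: "g \<in> carrier G" and M: "carrier M = A g" "zero M = \<zero>\<^bsub>R\<^esub>" "add M = (\<oplus>\<^bsub>R\<^esub>)"
  shows "abelian_group M"
proof (rule abelian_groupI)
  interpret B: additive_subgroup "A g" R by (rule component_subgroup[OF g])
  show "\<exists>y\<in>carrier M. y \<oplus>\<^bsub>M\<^esub> x = \<zero>\<^bsub>M\<^esub>" if "x \<in> carrier M" for x
  proof (rule bexI[of _ "\<ominus>\<^bsub>R\<^esub> x"])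
    show "\<ominus>\<^bsub>R\<^esub> x \<in> carrier M"
      using subgroup.m_inv_closed[OF B.a_subgroup] that M by (simp add: a_inv_def)
    show "\<ominus>\<^bsub>R\<^esub> x \<oplus>\<^bsub>M\<^esub> x = \<zero>\<^bsub>M\<^esub>"
      using that component_carrier[OF g] M by (simp add: R.l_neg)
  qed
qed (use component_carrier[OF g] component_subgroup[OF g] M in
    \<open>auto simp: R.a_ac additive_subgroup.a_closed component_zero[OF g]\<close>)

lemma right_component_module:
  assumes g: "g \<in> carrier G"
  shows "right_module (base_ring R G A) (right_mult_module R (A g))"
proof -
  have "abelian_group (right_mult_module R (A g))"
    by (rule component_abelian_group[OF g]) (simp_all add: right_mult_module_def)
  moreover have "x \<otimes>\<^bsub>R\<^esub> a \<in> A g" if "x \<in> A g" "a \<in> A \<one>\<^bsub>G\<^esub>" for a x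
    using component_mult[OF g G.one_closed that] g by simp
  moreover note component_carrier[OF g] component_carrier[OF G.one_closed]
  ultimately show ?thesis
    using base_ring_ring
    by (auto simp: right_module_def right_module_axioms_def base_ring_def right_mult_module_def
        R.l_distr R.r_distr R.m_assoc)
qed

lemma left_component_module:
  assumes g: "g \<in> carrier G"
  shows "right_module (opposite_ring (base_ring R G A)) (left_mult_module R (A g))"
proof -
  have "abelian_group (left_mult_module R (A g))"
    by (rule component_abelian_group[OF g]) (simp_all add: left_mult_module_def)
  moreover have "a \<otimes>\<^bsub>R\<^esub> x \<in> A g" if "a \<in> A \<one>\<^bsub>G\<^esub>" "x \<in> A g" for a x
    using component_mult[OF G.one_closed g that] g by simp
  moreover note component_carrier[OF g] component_carrier[OF G.one_closed]
  ultimately show ?thesis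
    using opposite_base_ring_ring
    by (auto simp: right_module_def right_module_axioms_def base_ring_def opposite_ring_def
        left_mult_module_def R.l_distr R.r_distr R.m_assoc)
qed

end


subsection \<open>Independence of projectivity from the choice of types\<close>

lemma mod_homD:
  assumes "h \<in> mod_hom S M N"
  shows "x \<in> carrier M \<Longrightarrow> h x \<in> carrier N"
    and "x \<in> carrier M \<Longrightarrow> y \<in> carrier M \<Longrightarrow> h (x \<oplus>\<^bsub>M\<^esub> y) = h x \<oplus>\<^bsub>N\<^esub> h y"
    and "a \<in> carrier S \<Longrightarrow> x \<in> carrier M \<Longrightarrow> h (a \<odot>\<^bsub>M\<^esub> x) = a \<odot>\<^bsub>N\<^esub> h x"
  using assms by (auto simp: mod_hom_def hom_def)

lemma mod_homI:
  assumes "\<And>x. x \<in> carrier M \<Longrightarrow> h x \<in> carrier N"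
    and "\<And>x y. x \<in> carrier M \<Longrightarrow> y \<in> carrier M \<Longrightarrow> h (x \<oplus>\<^bsub>M\<^esub> y) = h x \<oplus>\<^bsub>N\<^esub> h y"
    and "\<And>a x. a \<in> carrier S \<Longrightarrow> x \<in> carrier M \<Longrightarrow> h (a \<odot>\<^bsub>M\<^esub> x) = a \<odot>\<^bsub>N\<^esub> h x"
  shows "h \<in> mod_hom S M N"
  using assms by (auto simp: mod_hom_def hom_def)

lemma mod_hom_compose:
  assumes "h \<in> mod_hom S M N" "k \<in> mod_hom S N P"
  shows "(\<lambda>x. k (h x)) \<in> mod_hom S M P"
  by (rule mod_homI) (simp_all add: mod_homD[OF assms(1)] mod_homD[OF assms(2)])

lemma (in abelian_group) double_eq_imp_zero:
  assumes "x \<in> carrier G" "x \<oplus>\<^bsub>G\<^esub> x = x"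
  shows "x = \<zero>\<^bsub>G\<^esub>"
  using add.l_cancel_one[OF assms(1) assms(1)] assms(2) by simp

lemma (in right_module) smult_zero_left:
  assumes "x \<in> carrier M" shows "\<zero>\<^bsub>S\<^esub> \<odot>\<^bsub>M\<^esub> x = \<zero>\<^bsub>M\<^esub>"
  using smult_l_distr[of "\<zero>\<^bsub>S\<^esub>" "\<zero>\<^bsub>S\<^esub>" x] assms by (intro M.double_eq_imp_zero) auto

lemma (in right_module) smult_zero_right:
  assumes "a \<in> carrier S" shows "a \<odot>\<^bsub>M\<^esub> \<zero>\<^bsub>M\<^esub> = \<zero>\<^bsub>M\<^esub>"
  using smult_r_distr[of a "\<zero>\<^bsub>M\<^esub>" "\<zero>\<^bsub>M\<^esub>"] assms by (intro M.double_eq_imp_zero) auto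

lemma mod_hom_finsum:
  assumes "right_module S M" "right_module S N" and h: "h \<in> mod_hom S M N"
    and "finite F" and u: "u \<in> F \<rightarrow> carrier M"
  shows "h (\<Oplus>\<^bsub>M\<^esub>i\<in>F. u i) = (\<Oplus>\<^bsub>N\<^esub>i\<in>F. h (u i))"
proof -
  interpret M: right_module S M by fact
  interpret N: right_module S N by fact
  have "h \<zero>\<^bsub>M\<^esub> = \<zero>\<^bsub>N\<^esub>"
    using mod_homD(1)[OF h, of "\<zero>\<^bsub>M\<^esub>"] mod_homD(2)[OF h, of "\<zero>\<^bsub>M\<^esub>" "\<zero>\<^bsub>M\<^esub>"]
    by (intro N.M.double_eq_imp_zero) simp_all
  with \<open>finite F\<close> u show ?thesis
  proof (induction F rule: finite_induct)
    case (insert i F)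
    then have "u \<in> F \<rightarrow> carrier M" "u i \<in> carrier M" by auto
    with insert show ?case
      by (simp add: Pi_iff mod_homD[OF h])
  qed simp
qed

lemma right_module_free_module:
  fixes S :: "('a, 's) ring_scheme"
  assumes "ring S"
  shows "right_module S (free_module S I)"
proof -
  interpret S: ring S by fact
  have fin: "finite {i \<in> I. (\<lambda>i\<in>I. v i \<oplus>\<^bsub>S\<^esub> w i) i \<noteq> \<zero>\<^bsub>S\<^esub>}"
    if "finite {i \<in> I. v i \<noteq> \<zero>\<^bsub>S\<^esub>}" "finite {i \<in> I. w i \<noteq> \<zero>\<^bsub>S\<^esub>}" for v w :: "'b \<Rightarrow> 'a"
    by (rule finite_subset[OF _ finite_UnI[OF that]]) auto
  have fin': "finite {i \<in> I. (\<lambda>i\<in>I. v i \<otimes>\<^bsub>S\<^esub> a) i \<noteq> \<zero>\<^bsub>S\<^esub>}"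
    if "finite {i \<in> I. v i \<noteq> \<zero>\<^bsub>S\<^esub>}" "a \<in> carrier S" for v :: "'b \<Rightarrow> 'a" and a
    by (rule finite_subset[OF _ that(1)]) (use that in auto)
  have "abelian_group (free_module S I)"
  proof (rule abelian_groupI)
    fix v assume v: "v \<in> carrier (free_module S I)"
    let ?w = "\<lambda>i\<in>I. \<ominus>\<^bsub>S\<^esub> v i"
    have "finite {i \<in> I. ?w i \<noteq> \<zero>\<^bsub>S\<^esub>}"
      by (rule finite_subset[of _ "{i \<in> I. v i \<noteq> \<zero>\<^bsub>S\<^esub>}"])
        (use v in \<open>auto simp: free_module_def\<close>)
    then have "?w \<in> carrier (free_module S I)"
      using v by (auto simp: free_module_def PiE_iff)
    moreover have "?w \<oplus>\<^bsub>free_module S I\<^esub> v = \<zero>\<^bsub>free_module S I\<^esub>"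
      using v by (auto simp: free_module_def fun_eq_iff PiE_iff S.l_neg)
    ultimately show "\<exists>w\<in>carrier (free_module S I). w \<oplus>\<^bsub>free_module S I\<^esub> v = \<zero>\<^bsub>free_module S I\<^esub>"
      by blast
  next
    fix v w assume "v \<in> carrier (free_module S I)" "w \<in> carrier (free_module S I)"
    then show "v \<oplus>\<^bsub>free_module S I\<^esub> w \<in> carrier (free_module S I)"
      using fin[of v w] by (auto simp: free_module_def PiE_iff)
  qed (auto simp: free_module_def PiE_iff fun_eq_iff extensional_def S.a_ac)
  moreover have "a \<odot>\<^bsub>free_module S I\<^esub> v \<in> carrier (free_module S I)"
    if "a \<in> carrier S" "v \<in> carrier (free_module S I)" for a v
    using that fin'[of v a] by (auto simp: free_module_def PiE_iff)
  ultimately show ?thesis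
    using \<open>ring S\<close> unfolding right_module_def right_module_axioms_def
    by (auto simp: free_module_def PiE_iff fun_eq_iff extensional_def S.l_distr S.r_distr S.m_assoc)
qed

definition free_lift ::
  "('a, 's) ring_scheme \<Rightarrow> ('a, 'b, 'm) module_scheme \<Rightarrow> 'i set \<Rightarrow> ('i \<Rightarrow> 'b) \<Rightarrow> ('i \<Rightarrow> 'a) \<Rightarrow> 'b"
  where "free_lift S M I u v = (\<Oplus>\<^bsub>M\<^esub>i\<in>{i \<in> I. v i \<noteq> \<zero>\<^bsub>S\<^esub>}. v i \<odot>\<^bsub>M\<^esub> u i)"

lemma free_lift_superset:
  assumes "right_module S M" and u: "u \<in> I \<rightarrow> carrier M" and v: "v \<in> carrier (free_module S I)"
    and F: "finite F" "F \<subseteq> I" "{i \<in> I. v i \<noteq> \<zero>\<^bsub>S\<^esub>} \<subseteq> F"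
  shows "free_lift S M I u v = (\<Oplus>\<^bsub>M\<^esub>i\<in>F. v i \<odot>\<^bsub>M\<^esub> u i)"
proof -
  interpret M: right_module S M by fact
  have vc: "v i \<in> carrier S" "u i \<in> carrier M" if "i \<in> I" for i
    using v u that by (auto simp: free_module_def)
  show ?thesis
    unfolding free_lift_def using F vc
    by (intro M.add.finprod_mono_neutral_cong_left) (auto simp: M.smult_zero_left)
qed

lemma free_lift_hom:
  fixes I :: "'i set"
  assumes M: "right_module S M" and u: "u \<in> I \<rightarrow> carrier M"
  shows "free_lift S M I u \<in> mod_hom S (free_module S I) M"
proof (rule mod_homI)
  interpret M: right_module S M by fact
  interpret F: right_module S "free_module S I"
    by (rule right_module_free_module) (rule M.ring_axioms)
  have vc: "v i \<in> carrier S" "u i \<in> carrier M" if "i \<in> I" "v \<in> carrier (free_module S I)" for i v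
    using u that by (auto simp: free_module_def)
  have fin: "finite {i \<in> I. v i \<noteq> \<zero>\<^bsub>S\<^esub>}" if "v \<in> carrier (free_module S I)" for v
    using that by (simp add: free_module_def)
  fix v assume v: "v \<in> carrier (free_module S I)"
  show "free_lift S M I u v \<in> carrier M"
    unfolding free_lift_def using vc v by (intro M.M.finsum_closed) auto
  {
    fix w assume w: "w \<in> carrier (free_module S I)"
    let ?F = "{i \<in> I. v i \<noteq> \<zero>\<^bsub>S\<^esub>} \<union> {i \<in> I. w i \<noteq> \<zero>\<^bsub>S\<^esub>}"
    let ?s = "v \<oplus>\<^bsub>free_module S I\<^esub> w"
    have si: "?s i = v i \<oplus>\<^bsub>S\<^esub> w i" if "i \<in> I" for i
      using that by (simp add: free_module_def)
    have "free_lift S M I u ?s = (\<Oplus>\<^bsub>M\<^esub>i\<in>?F. ?s i \<odot>\<^bsub>M\<^esub> u i)"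
      using v w fin u M by (intro free_lift_superset) (auto simp: si)
    also have "\<dots> = (\<Oplus>\<^bsub>M\<^esub>i\<in>?F. v i \<odot>\<^bsub>M\<^esub> u i \<oplus>\<^bsub>M\<^esub> w i \<odot>\<^bsub>M\<^esub> u i)"
      using vc v w by (intro M.M.finsum_cong') (auto simp: si M.smult_l_distr)
    also have "\<dots> = (\<Oplus>\<^bsub>M\<^esub>i\<in>?F. v i \<odot>\<^bsub>M\<^esub> u i) \<oplus>\<^bsub>M\<^esub> (\<Oplus>\<^bsub>M\<^esub>i\<in>?F. w i \<odot>\<^bsub>M\<^esub> u i)"
      using vc v w by (intro M.M.finsum_addf) auto
    also have "(\<Oplus>\<^bsub>M\<^esub>i\<in>?F. v i \<odot>\<^bsub>M\<^esub> u i) = free_lift S M I u v"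
      using v w fin u M by (intro free_lift_superset[symmetric]) auto
    also have "(\<Oplus>\<^bsub>M\<^esub>i\<in>?F. w i \<odot>\<^bsub>M\<^esub> u i) = free_lift S M I u w"
      using v w fin u M by (intro free_lift_superset[symmetric]) auto
    finally show "free_lift S M I u ?s = free_lift S M I u v \<oplus>\<^bsub>M\<^esub> free_lift S M I u w" .
  next
    fix a assume a: "a \<in> carrier S"
    let ?F = "{i \<in> I. v i \<noteq> \<zero>\<^bsub>S\<^esub>}"
    let ?s = "a \<odot>\<^bsub>free_module S I\<^esub> v"
    have si: "?s i = v i \<otimes>\<^bsub>S\<^esub> a" if "i \<in> I" for i
      using that by (simp add: free_module_def)
    have act: "a \<odot>\<^bsub>M\<^esub> (\<Oplus>\<^bsub>M\<^esub>i\<in>F. y i) = (\<Oplus>\<^bsub>M\<^esub>i\<in>F. a \<odot>\<^bsub>M\<^esub> y i)"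
      if "finite F" "y \<in> F \<rightarrow> carrier M" for F :: "'i set" and y
      using that by (induction F rule: finite_induct)
        (use a in \<open>simp_all add: M.smult_zero_right M.smult_r_distr Pi_iff\<close>)
    have "free_lift S M I u ?s = (\<Oplus>\<^bsub>M\<^esub>i\<in>?F. ?s i \<odot>\<^bsub>M\<^esub> u i)"
      using v a fin u M by (intro free_lift_superset) (auto simp: si)
    also have "\<dots> = (\<Oplus>\<^bsub>M\<^esub>i\<in>?F. a \<odot>\<^bsub>M\<^esub> (v i \<odot>\<^bsub>M\<^esub> u i))"
      using vc v a by (intro M.M.finsum_cong') (auto simp: si M.smult_assoc)
    also have "\<dots> = a \<odot>\<^bsub>M\<^esub> free_lift S M I u v"
      unfolding free_lift_def using fin[OF v] vc[OF _ v] by (intro act[symmetric]) auto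
    finally show "free_lift S M I u ?s = a \<odot>\<^bsub>M\<^esub> free_lift S M I u v" .
  }
qed

lemma projective_module_lift:
  fixes S :: "('a, 's) ring_scheme" and M :: "('a, 'b) module"
    and N :: "('a, 'c, 'n) module_scheme" and N' :: "('a, 'd, 'k) module_scheme"
  assumes proj: "projective_module S M"
    and N: "right_module S N" and N': "right_module S N'"
    and p: "p \<in> mod_epi S N N'" and f: "f \<in> mod_hom S M N'"
  shows "\<exists>h\<in>mod_hom S M N. \<forall>x\<in>carrier M. p (h x) = f x"
proof -
  have M: "right_module S M" using proj by (simp add: projective_module_def)
  interpret M: right_module S M by fact
  interpret N: right_module S N by fact
  interpret N': right_module S N' by fact
  let ?L = "free_module S (carrier M)"
  let ?e = "free_lift S M (carrier M) id"
  have L: "right_module S ?L" by (rule right_module_free_module) (rule M.ring_axioms)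
  have e: "?e \<in> mod_hom S ?L M" using M by (rule free_lift_hom) simp
  have "x \<in> ?e ` carrier ?L" if x: "x \<in> carrier M" for x
  proof
    let ?v = "\<lambda>y\<in>carrier M. if y = x then \<one>\<^bsub>S\<^esub> else \<zero>\<^bsub>S\<^esub>"
    have "finite {y \<in> carrier M. ?v y \<noteq> \<zero>\<^bsub>S\<^esub>}"
      by (rule finite_subset[of _ "{x}"]) auto
    then show v: "?v \<in> carrier ?L" by (auto simp: free_module_def)
    have "?e ?v = (\<Oplus>\<^bsub>M\<^esub>i\<in>{x}. ?v i \<odot>\<^bsub>M\<^esub> id i)"
      using x v M by (intro free_lift_superset) auto
    then show "x = ?e ?v" using x by simp
  qed
  then have "?e \<in> mod_epi S ?L M" using e mod_homD(1)[OF e] by (auto simp: mod_epi_def)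
  moreover have "(\<lambda>x. x) \<in> mod_hom S M M" by (rule mod_homI) auto
  ultimately obtain s where s: "s \<in> mod_hom S M ?L" "\<And>x. x \<in> carrier M \<Longrightarrow> ?e (s x) = x"
    using proj M L unfolding projective_module_def by blast
  have ph: "p \<in> mod_hom S N N'" and surj: "p ` carrier N = carrier N'"
    using p by (auto simp: mod_epi_def)
  have "\<forall>x\<in>carrier M. \<exists>y\<in>carrier N. p y = f x"
    using surj mod_homD(1)[OF f] by (metis imageE)
  then obtain u where u: "\<And>x. x \<in> carrier M \<Longrightarrow> u x \<in> carrier N \<and> p (u x) = f x" by metis
  let ?k = "free_lift S N (carrier M) u"
  have k: "?k \<in> mod_hom S ?L N" using N by (rule free_lift_hom) (use u in auto)
  have pk: "p (?k v) = f (?e v)" if v: "v \<in> carrier ?L" for v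
  proof -
    let ?F = "{i \<in> carrier M. v i \<noteq> \<zero>\<^bsub>S\<^esub>}"
    have F: "finite ?F" "\<And>i. i \<in> carrier M \<Longrightarrow> v i \<in> carrier S"
      using v by (auto simp: free_module_def)
    have "p (?k v) = (\<Oplus>\<^bsub>N'\<^esub>i\<in>?F. p (v i \<odot>\<^bsub>N\<^esub> u i))"
      unfolding free_lift_def using F u by (intro mod_hom_finsum[OF N N' ph]) auto
    also have "\<dots> = (\<Oplus>\<^bsub>N'\<^esub>i\<in>?F. f (v i \<odot>\<^bsub>M\<^esub> id i))"
      using F u mod_homD(1)[OF f]
      by (intro N'.M.finsum_cong') (auto simp: mod_homD(3)[OF ph] mod_homD(3)[OF f])
    also have "\<dots> = f (?e v)"
      unfolding free_lift_def using F by (intro mod_hom_finsum[OF M N' f, symmetric]) auto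
    finally show ?thesis .
  qed
  show ?thesis
  proof (rule bexI)
    show "(\<lambda>x. ?k (s x)) \<in> mod_hom S M N" by (rule mod_hom_compose[OF s(1) k])
    show "\<forall>x\<in>carrier M. p (?k (s x)) = f x" using pk s mod_homD(1)[OF s(1)] by auto
  qed
qed

end

theory Submission
  imports Defs
begin

text \<open>
  An epimorphism onto a free module splits, so a ring \<open>S\<close> fails to have unbounded generating number
  exactly when, for some \<open>n\<close>, there are an \<open>(n + 1) \<times> n\<close> matrix \<open>a\<close> and an \<open>n \<times> (n + 1)\<close> matrix \<open>b\<close>
  over \<open>S\<close> with \<open>a b = 1\<close> (\<open>UGN_iff\<close>).  In this form the property visibly passes to subrings, which
  gives one implication.  It is also visibly left-right symmetric, by transposition.

  For the other implication, suppose that such matrices exist over \<open>R\<close>.  Only finitely many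
  degrees occur in their entries, and these degrees generate a finite subgroup \<open>H\<close> of \<open>G\<close>; so the
  matrices live over the subring \<open>R\<^sub>H\<close> of elements supported on \<open>H\<close>
  (\<open>free_retract_in_supported_on\<close>).  This subring is generated over \<open>R\<^sub>1\<close>, as a right module
  say, by finitely many elements \<open>x\<^sub>1, \<dots>, x\<^sub>d\<close>, because each \<open>R\<^sub>h\<close> is finitely generated.  The
  projection \<open>p\<close> to the component of degree one is \<open>R\<^sub>1\<close>-linear with \<open>p(1) = 1\<close>.  By iteration there are,
  for every \<open>m\<close>, an \<open>m \<times> n\<close> matrix \<open>a\<close> and an \<open>n \<times> m\<close> matrix \<open>b\<close> over \<open>R\<^sub>H\<close> with \<open>a b = 1\<close>, where \<open>n\<close>
  is fixed.  Writing \<open>b\<^sub>j\<^sub>k = \<Sum>\<^sub>t x\<^sub>t c\<^sub>j\<^sub>t\<^sub>k\<close> with coefficients in \<open>R\<^sub>1\<close> and applying \<open>p\<close> to the entries of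
  \<open>a b = 1\<close> gives \<open>\<Sum>\<^sub>j\<^sub>,\<^sub>t p(a\<^sub>i\<^sub>j x\<^sub>t) c\<^sub>j\<^sub>t\<^sub>k = \<delta>\<^sub>i\<^sub>k\<close>, an identity of matrices over \<open>R\<^sub>1\<close> whose inner dimension \<open>n d\<close> does
  not depend on \<open>m\<close> (\<open>free_retract_descends\<close>).  Taking \<open>m = n d + 1\<close> shows that \<open>R\<^sub>1\<close> does not have
  unbounded generating number.  If the components are finitely generated as left modules, the same
  argument is carried out over the opposite ring.
\<close>


section \<open>Finite sums\<close>

context ring
begin

lemma subring_carrier: "subring B R \<Longrightarrow> x \<in> B \<Longrightarrow> x \<in> carrier R"
  using subringE(1) by blast

lemma subring_finsum_closed:
  assumes B: "subring B R" and f: "f \<in> F \<rightarrow> B"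
  shows "(\<Oplus>i\<in>F. f i) \<in> B"
  using f
proof (induction F rule: infinite_finite_induct)
  case (insert i F)
  then have "f i \<in> carrier R" "f \<in> F \<rightarrow> carrier R"
    using subring_carrier[OF B] by auto
  with insert show ?case
    by (simp add: subringE(7)[OF B] Pi_iff)
qed (simp_all add: subringE(2)[OF B])

lemma finsum_subring:
  assumes B: "subring B R" and f: "f \<in> F \<rightarrow> B"
  shows "(\<Oplus>\<^bsub>R\<lparr>carrier := B\<rparr>\<^esub>i\<in>F. f i) = (\<Oplus>i\<in>F. f i)"
proof -
  interpret B: ring "R\<lparr>carrier := B\<rparr>" by (rule subring_is_ring[OF B])
  show ?thesis
    using f
  proof (induction F rule: infinite_finite_induct)
    case (infinite F)
    then show ?case using B.finsum_infinite[of F f] by simp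
  next
    case empty
    then show ?case using B.finsum_empty[of f] by simp
  next
    case (insert i F)
    then have f: "f i \<in> carrier R" "f \<in> F \<rightarrow> carrier R" "f i \<in> B" "f \<in> F \<rightarrow> B"
      using subring_carrier[OF B] by auto
    with insert show ?case
      using B.finsum_insert[of F i f] by simp
  qed
qed

lemma finsum_Times:
  assumes "finite I" "finite J" and f: "\<And>i j. i \<in> I \<Longrightarrow> j \<in> J \<Longrightarrow> f (i, j) \<in> carrier R"
  shows "(\<Oplus>p\<in>I \<times> J. f p) = (\<Oplus>i\<in>I. \<Oplus>j\<in>J. f (i, j))"
  using \<open>finite I\<close> f
proof (induction I rule: finite_induct)
  case (insert i I)
  have "(\<Oplus>p\<in>insert i I \<times> J. f p) = (\<Oplus>p\<in>Pair i ` J \<union> I \<times> J. f p)"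
    by (rule arg_cong[of _ _ "finsum R f"]) auto
  also have "\<dots> = (\<Oplus>p\<in>Pair i ` J. f p) \<oplus> (\<Oplus>p\<in>I \<times> J. f p)"
    using insert \<open>finite J\<close> by (intro finsum_Un_disjoint) auto
  also have "(\<Oplus>p\<in>Pair i ` J. f p) = (\<Oplus>j\<in>J. f (i, j))"
    using insert by (intro finsum_reindex) (auto simp: inj_on_def)
  also have "(\<Oplus>p\<in>I \<times> J. f p) = (\<Oplus>i\<in>I. \<Oplus>j\<in>J. f (i, j))"
    using insert by auto
  finally show ?case
    using insert by (simp add: Pi_iff)
qed simp

text \<open>Associativity of the product of a row, a matrix and a column.\<close>

lemma finsum_mult_assoc:
  assumes "finite J" "finite K"
    and a: "\<And>j. j \<in> J \<Longrightarrow> a j \<in> carrier R"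
    and b: "\<And>j k. j \<in> J \<Longrightarrow> k \<in> K \<Longrightarrow> b j k \<in> carrier R"
    and c: "\<And>k. k \<in> K \<Longrightarrow> c k \<in> carrier R"
  shows "(\<Oplus>j\<in>J. a j \<otimes> (\<Oplus>k\<in>K. b j k \<otimes> c k)) = (\<Oplus>k\<in>K. (\<Oplus>j\<in>J. a j \<otimes> b j k) \<otimes> c k)"
  using \<open>finite J\<close> a b
proof (induction J rule: finite_induct)
  case empty
  have "(\<Oplus>k\<in>K. \<zero> \<otimes> c k) = (\<Oplus>k\<in>K. \<zero>)"
    using c by (intro finsum_cong') auto
  then show ?case by simp
next
  case (insert i J)
  have "(\<Oplus>j\<in>insert i J. a j \<otimes> (\<Oplus>k\<in>K. b j k \<otimes> c k)) =
      a i \<otimes> (\<Oplus>k\<in>K. b i k \<otimes> c k) \<oplus> (\<Oplus>j\<in>J. a j \<otimes> (\<Oplus>k\<in>K. b j k \<otimes> c k))"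
    using insert c by (intro finsum_insert) (auto intro!: finsum_closed m_closed)
  also have "(\<Oplus>j\<in>J. a j \<otimes> (\<Oplus>k\<in>K. b j k \<otimes> c k)) = (\<Oplus>k\<in>K. (\<Oplus>j\<in>J. a j \<otimes> b j k) \<otimes> c k)"
    using insert by auto
  also have "a i \<otimes> (\<Oplus>k\<in>K. b i k \<otimes> c k) = (\<Oplus>k\<in>K. a i \<otimes> (b i k \<otimes> c k))"
    using insert c \<open>finite K\<close> by (intro finsum_rdistr) auto
  also have "\<dots> \<oplus> (\<Oplus>k\<in>K. (\<Oplus>j\<in>J. a j \<otimes> b j k) \<otimes> c k) =
      (\<Oplus>k\<in>K. a i \<otimes> (b i k \<otimes> c k) \<oplus> (\<Oplus>j\<in>J. a j \<otimes> b j k) \<otimes> c k)"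
    using insert c by (intro finsum_addf[symmetric]) (auto intro!: finsum_closed m_closed)
  also have "\<dots> = (\<Oplus>k\<in>K. (\<Oplus>j\<in>insert i J. a j \<otimes> b j k) \<otimes> c k)"
    using insert c
    by (intro finsum_cong') (auto intro!: finsum_closed m_closed simp: l_distr m_assoc Pi_iff)
  finally show ?case .
qed

lemma additive_zero:
  assumes cl: "\<And>x. x \<in> carrier R \<Longrightarrow> p x \<in> carrier R"
    and add: "\<And>x y. x \<in> carrier R \<Longrightarrow> y \<in> carrier R \<Longrightarrow> p (x \<oplus> y) = p x \<oplus> p y"
  shows "p \<zero> = \<zero>"
  using add[of \<zero> \<zero>] cl[of \<zero>] by (intro double_eq_imp_zero) simp_all

lemma additive_finsum:
  assumes cl: "\<And>x. x \<in> carrier R \<Longrightarrow> p x \<in> carrier R"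
    and add: "\<And>x y. x \<in> carrier R \<Longrightarrow> y \<in> carrier R \<Longrightarrow> p (x \<oplus> y) = p x \<oplus> p y"
    and f: "f \<in> F \<rightarrow> carrier R"
  shows "p (\<Oplus>i\<in>F. f i) = (\<Oplus>i\<in>F. p (f i))"
  using f
proof (induction F rule: infinite_finite_induct)
  case (insert i F)
  then show ?case by (simp add: Pi_iff cl add)
qed (simp_all add: additive_zero[of p, OF cl add])

end


section \<open>Retracts of free modules\<close>

text \<open>
  For a subring \<open>B\<close> of \<open>R\<close> and finite index sets, \<open>free_retract R B I J\<close> says that the free
  \<open>B\<close>-module on \<open>I\<close> is a retract of the free \<open>B\<close>-module on \<open>J\<close>: there are an \<open>I \<times> J\<close> matrix
  and a \<open>J \<times> I\<close> matrix over \<open>B\<close> whose product is the identity.  The ambient ring \<open>R\<close> is kept as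
  a parameter so that matrices over different subrings can be multiplied with one another.
\<close>

definition free_retract :: "('a, 'm) ring_scheme \<Rightarrow> 'a set \<Rightarrow> 'i set \<Rightarrow> 'j set \<Rightarrow> bool"
  where "free_retract R B I J \<longleftrightarrow> (\<exists>a b.
    (\<forall>i\<in>I. \<forall>j\<in>J. a i j \<in> B) \<and> (\<forall>j\<in>J. \<forall>i\<in>I. b j i \<in> B) \<and>
    (\<forall>i\<in>I. \<forall>k\<in>I. (\<Oplus>\<^bsub>R\<^esub>j\<in>J. a i j \<otimes>\<^bsub>R\<^esub> b j k) = (if i = k then \<one>\<^bsub>R\<^esub> else \<zero>\<^bsub>R\<^esub>)))"

lemma free_retractI:
  assumes "\<And>i j. i \<in> I \<Longrightarrow> j \<in> J \<Longrightarrow> a i j \<in> B" "\<And>i j. i \<in> I \<Longrightarrow> j \<in> J \<Longrightarrow> b j i \<in> B"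
    and "\<And>i k. i \<in> I \<Longrightarrow> k \<in> I \<Longrightarrow> (\<Oplus>\<^bsub>R\<^esub>j\<in>J. a i j \<otimes>\<^bsub>R\<^esub> b j k) = (if i = k then \<one>\<^bsub>R\<^esub> else \<zero>\<^bsub>R\<^esub>)"
  shows "free_retract R B I J"
  using assms unfolding free_retract_def by blast

lemma free_retractE:
  assumes "free_retract R B I J"
  obtains a b where
    "\<And>i j. i \<in> I \<Longrightarrow> j \<in> J \<Longrightarrow> a i j \<in> B" "\<And>i j. i \<in> I \<Longrightarrow> j \<in> J \<Longrightarrow> b j i \<in> B"
    "\<And>i k. i \<in> I \<Longrightarrow> k \<in> I \<Longrightarrow> (\<Oplus>\<^bsub>R\<^esub>j\<in>J. a i j \<otimes>\<^bsub>R\<^esub> b j k) = (if i = k then \<one>\<^bsub>R\<^esub> else \<zero>\<^bsub>R\<^esub>)"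
  using assms unfolding free_retract_def by blast

lemma free_retract_mono: "free_retract R B I J \<Longrightarrow> B \<subseteq> C \<Longrightarrow> free_retract R C I J"
  unfolding free_retract_def by blast

text \<open>Over the opposite ring the roles of the two matrices are exchanged by transposition.\<close>

lemma free_retract_opposite:
  fixes R :: "('a, 'm) ring_scheme" and I :: "'i set" and J :: "'j set"
  shows "free_retract (opposite_ring R) B I J \<longleftrightarrow> free_retract R B I J"
proof -
  have sum: "finsum (opposite_ring R) f J = finsum R f J" for f :: "'j \<Rightarrow> 'a"
    by (simp add: finsum_def opposite_ring_def)
  have *: "free_retract Q B I J"
    if "free_retract P B I J" and Q: "\<And>f :: 'j \<Rightarrow> 'a. finsum Q f J = finsum P f J" "\<And>x y. x \<otimes>\<^bsub>Q\<^esub> y = y \<otimes>\<^bsub>P\<^esub> x"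
      "\<one>\<^bsub>Q\<^esub> = \<one>\<^bsub>P\<^esub>" "\<zero>\<^bsub>Q\<^esub> = \<zero>\<^bsub>P\<^esub>" for P Q :: "('a, 'm) ring_scheme"
    using that(1)
  proof (rule free_retractE)
    fix a b
    assume "\<And>i j. i \<in> I \<Longrightarrow> j \<in> J \<Longrightarrow> a i j \<in> B" "\<And>i j. i \<in> I \<Longrightarrow> j \<in> J \<Longrightarrow> b j i \<in> B"
      "\<And>i k. i \<in> I \<Longrightarrow> k \<in> I \<Longrightarrow> (\<Oplus>\<^bsub>P\<^esub>j\<in>J. a i j \<otimes>\<^bsub>P\<^esub> b j k) = (if i = k then \<one>\<^bsub>P\<^esub> else \<zero>\<^bsub>P\<^esub>)"
    then show ?thesis
      by (intro free_retractI[of I J "\<lambda>i j. b j i" B "\<lambda>j i. a i j"]) (auto simp: Q)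
  qed
  show ?thesis
    by (rule iffI; erule *) (simp_all add: sum, simp_all add: opposite_ring_def)
qed

context ring
begin

lemma free_retract_subring:
  assumes B: "subring B R"
  shows "free_retract (R\<lparr>carrier := B\<rparr>) B I J \<longleftrightarrow> free_retract R B I J"
proof -
  have "(\<Oplus>\<^bsub>R\<lparr>carrier := B\<rparr>\<^esub>j\<in>J. a i j \<otimes>\<^bsub>R\<^esub> b j k) = (\<Oplus>j\<in>J. a i j \<otimes> b j k)"
    if "\<forall>i\<in>I. \<forall>j\<in>J. a i j \<in> B" "\<forall>j\<in>J. \<forall>i\<in>I. b j i \<in> B" "i \<in> I" "k \<in> I" for a b i k
    using that subringE(6)[OF B] by (intro finsum_subring[OF B]) auto
  then show ?thesis
    unfolding free_retract_def by (auto cong: conj_cong)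
qed

lemma free_retract_trans:
  assumes B: "subring B R" and fin: "finite J" "finite K"
    and IJ: "free_retract R B I J" and JK: "free_retract R B J K"
  shows "free_retract R B I K"
proof -
  obtain a b where a: "\<And>i j. i \<in> I \<Longrightarrow> j \<in> J \<Longrightarrow> a i j \<in> B"
    and b: "\<And>i j. i \<in> I \<Longrightarrow> j \<in> J \<Longrightarrow> b j i \<in> B"
    and ab: "\<And>i k. i \<in> I \<Longrightarrow> k \<in> I \<Longrightarrow> (\<Oplus>j\<in>J. a i j \<otimes> b j k) = (if i = k then \<one> else \<zero>)"
    using IJ by (rule free_retractE) blast
  obtain c d where c: "\<And>i j. i \<in> J \<Longrightarrow> j \<in> K \<Longrightarrow> c i j \<in> B"
    and d: "\<And>i j. i \<in> J \<Longrightarrow> j \<in> K \<Longrightarrow> d j i \<in> B"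
    and cd: "\<And>i k. i \<in> J \<Longrightarrow> k \<in> J \<Longrightarrow> (\<Oplus>j\<in>K. c i j \<otimes> d j k) = (if i = k then \<one> else \<zero>)"
    using JK by (rule free_retractE) blast
  note carr = subring_carrier[OF B]
  show ?thesis
  proof (rule free_retractI)
    fix i k assume i: "i \<in> I" and k: "k \<in> K"
    show "(\<Oplus>j\<in>J. a i j \<otimes> c j k) \<in> B"
      using i k a c by (intro subring_finsum_closed[OF B]) (auto intro: subringE(6)[OF B])
    show "(\<Oplus>j\<in>J. d k j \<otimes> b j i) \<in> B"
      using i k b d by (intro subring_finsum_closed[OF B]) (auto intro: subringE(6)[OF B])
  next
    fix i l assume i: "i \<in> I" and l: "l \<in> I"
    have "(\<Oplus>k\<in>K. (\<Oplus>j\<in>J. a i j \<otimes> c j k) \<otimes> (\<Oplus>j\<in>J. d k j \<otimes> b j l)) =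
        (\<Oplus>j\<in>J. a i j \<otimes> (\<Oplus>k\<in>K. c j k \<otimes> (\<Oplus>j\<in>J. d k j \<otimes> b j l)))"
      using i l fin a b c d carr
      by (intro finsum_mult_assoc[symmetric]) (auto intro!: finsum_closed)
    also have "\<dots> = (\<Oplus>j\<in>J. a i j \<otimes> b j l)"
    proof (rule finsum_cong')
      fix j assume j: "j \<in> J"
      have "(\<Oplus>k\<in>K. c j k \<otimes> (\<Oplus>m\<in>J. d k m \<otimes> b m l)) = (\<Oplus>m\<in>J. (\<Oplus>k\<in>K. c j k \<otimes> d k m) \<otimes> b m l)"
        using j l fin b c d carr by (intro finsum_mult_assoc) auto
      also have "\<dots> = (\<Oplus>m\<in>J. if j = m then b m l else \<zero>)"
        using j l b carr by (intro finsum_cong') (auto simp: cd)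
      also have "\<dots> = b j l"
        using j l b carr fin by (intro finsum_singleton) auto
      finally show "a i j \<otimes> (\<Oplus>k\<in>K. c j k \<otimes> (\<Oplus>m\<in>J. d k m \<otimes> b m l)) = a i j \<otimes> b j l"
        by simp
    qed (use i l a b carr in auto)
    finally show "(\<Oplus>k\<in>K. (\<Oplus>j\<in>J. a i j \<otimes> c j k) \<otimes> (\<Oplus>j\<in>J. d k j \<otimes> b j l)) =
        (if i = l then \<one> else \<zero>)"
      using ab[OF i l] by simp
  qed
qed

text \<open>A free summand of rank one may be added to both modules; the new matrices are block diagonal.\<close>

lemma free_retract_insert:
  assumes B: "subring B R" and J: "finite J" "y \<notin> J" and x: "x \<notin> I" and IJ: "free_retract R B I J"
  shows "free_retract R B (insert x I) (insert y J)"
proof -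
  obtain a b where a: "\<And>i j. i \<in> I \<Longrightarrow> j \<in> J \<Longrightarrow> a i j \<in> B"
    and b: "\<And>i j. i \<in> I \<Longrightarrow> j \<in> J \<Longrightarrow> b j i \<in> B"
    and ab: "\<And>i k. i \<in> I \<Longrightarrow> k \<in> I \<Longrightarrow> (\<Oplus>j\<in>J. a i j \<otimes> b j k) = (if i = k then \<one> else \<zero>)"
    using IJ by (rule free_retractE) blast
  note carr = subring_carrier[OF B]
  define a' where "a' i j = (if i = x \<and> j = y then \<one> else if i = x \<or> j = y then \<zero> else a i j)" for i j
  define b' where "b' j i = (if i = x \<and> j = y then \<one> else if i = x \<or> j = y then \<zero> else b j i)" for i j
  show ?thesis
  proof (rule free_retractI)
    fix i j assume ij: "i \<in> insert x I" "j \<in> insert y J"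
    show "a' i j \<in> B" "b' j i \<in> B"
      using ij a b subringE(2,3)[OF B] by (auto simp: a'_def b'_def)
  next
    fix i k assume i: "i \<in> insert x I" and k: "k \<in> insert x I"
    have cl: "a' i j \<otimes> b' j k \<in> carrier R" if "j \<in> insert y J" for j
      using i k that a b carr by (auto simp: a'_def b'_def)
    have "(\<Oplus>j\<in>insert y J. a' i j \<otimes> b' j k) = a' i y \<otimes> b' y k \<oplus> (\<Oplus>j\<in>J. a' i j \<otimes> b' j k)"
      using J cl by (intro finsum_insert) auto
    also have "(\<Oplus>j\<in>J. a' i j \<otimes> b' j k) = (if i = x \<or> k = x then \<zero> else if i = k then \<one> else \<zero>)"
    proof (cases "i = x \<or> k = x")
      case True
      have "a' i j \<otimes> b' j k = \<zero>" if "j \<in> J" for j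
        using True that J i k a b carr by (auto simp: a'_def b'_def)
      then have "(\<Oplus>j\<in>J. a' i j \<otimes> b' j k) = (\<Oplus>j\<in>J. \<zero>)"
        by (intro finsum_cong') auto
      then show ?thesis using True by simp
    next
      case False
      have "(\<Oplus>j\<in>J. a' i j \<otimes> b' j k) = (\<Oplus>j\<in>J. a i j \<otimes> b j k)"
        using False J i k a b carr by (intro finsum_cong') (auto simp: a'_def b'_def)
      then show ?thesis using False i k ab[of i k] by simp
    qed
    finally show "(\<Oplus>j\<in>insert y J. a' i j \<otimes> b' j k) = (if i = k then \<one> else \<zero>)"
      using i k by (auto simp: a'_def b'_def)
  qed
qed

text \<open>A retraction of \<open>B\<^sup>n\<close> onto \<open>B\<^sup>n\<^sup>+\<^sup>1\<close> yields one onto \<open>B\<^sup>n\<^sup>+\<^sup>2\<close>, by adding a free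
  summand of rank one, and so on.\<close>

lemma free_retract_iterate:
  assumes B: "subring B R" and n: "free_retract R B {..<Suc n} {..<n}"
  shows "free_retract R B {..<n + k} {..<n}"
proof (induction k)
  case 0
  show ?case
  proof (rule free_retractI[of _ _ "\<lambda>i j. if i = j then \<one> else \<zero>" _ "\<lambda>i j. if i = j then \<one> else \<zero>"])
    fix i k assume "i \<in> {..<n + 0}" "k \<in> {..<n + 0}"
    then have "(\<Oplus>j\<in>{..<n}. (if i = j then \<one> else \<zero>) \<otimes> (if j = k then \<one> else \<zero>)) =
        (\<Oplus>j\<in>{..<n}. if i = j then (if j = k then \<one> else \<zero>) else \<zero>)"
      by (intro finsum_cong') auto
    also have "\<dots> = (if i = k then \<one> else \<zero>)"
      using \<open>i \<in> _\<close> by (intro finsum_singleton) auto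
    finally show "(\<Oplus>j\<in>{..<n}. (if i = j then \<one> else \<zero>) \<otimes> (if j = k then \<one> else \<zero>)) =
        (if i = k then \<one> else \<zero>)" .
  qed (auto simp: subringE(2,3)[OF B])
next
  case (Suc k)
  have "free_retract R B {..<Suc (n + k)} {..<n + k}"
  proof (induction k)
    case (Suc k)
    then show ?case
      using free_retract_insert[OF B, of "{..<n + k}" "n + k" "Suc (n + k)" "{..<Suc (n + k)}"]
      by (simp add: lessThan_Suc)
  qed (use n in simp)
  from free_retract_trans[OF B _ _ this Suc] show ?case by simp
qed

text \<open>Only the cardinalities of the index sets matter: a smaller \<open>I\<close> is reached by omitting rows
  of the first matrix and columns of the second, a larger \<open>J\<close> by padding both with zeros.\<close>

lemma free_retract_card:
  assumes B: "subring B R" and IJ: "free_retract R B I J"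
    and fin: "finite I" "finite J" "finite I'" "finite J'"
    and card: "card I' \<le> card I" "card J \<le> card J'"
  shows "free_retract R B I' J'"
proof -
  obtain a b where a: "\<And>i j. i \<in> I \<Longrightarrow> j \<in> J \<Longrightarrow> a i j \<in> B"
    and b: "\<And>i j. i \<in> I \<Longrightarrow> j \<in> J \<Longrightarrow> b j i \<in> B"
    and ab: "\<And>i k. i \<in> I \<Longrightarrow> k \<in> I \<Longrightarrow> (\<Oplus>j\<in>J. a i j \<otimes> b j k) = (if i = k then \<one> else \<zero>)"
    using IJ by (rule free_retractE) blast
  note carr = subring_carrier[OF B]
  obtain f where f: "f ` I' \<subseteq> I" "inj_on f I'"
    using card_le_inj[OF fin(3,1) card(1)] by blast
  obtain g where g: "g ` J \<subseteq> J'" "inj_on g J"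
    using card_le_inj[OF fin(2,4) card(2)] by blast
  let ?g = "inv_into J g"
  have gJ: "?g j \<in> J" if "j \<in> g ` J" for j
    using that by (rule inv_into_into)
  show ?thesis
  proof (rule free_retractI)
    fix i j assume ij: "i \<in> I'" "j \<in> J'"
    show "(if j \<in> g ` J then a (f i) (?g j) else \<zero>) \<in> B"
      using ij f a gJ subringE(2)[OF B] by auto
    show "(if j \<in> g ` J then b (?g j) (f i) else \<zero>) \<in> B"
      using ij f b gJ subringE(2)[OF B] by auto
  next
    fix i k assume ik: "i \<in> I'" "k \<in> I'"
    have fik: "f i \<in> I" "f k \<in> I" using ik f by auto
    have "(\<Oplus>j\<in>J'. (if j \<in> g ` J then a (f i) (?g j) else \<zero>) \<otimes>
          (if j \<in> g ` J then b (?g j) (f k) else \<zero>)) =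
        (\<Oplus>j\<in>g ` J. a (f i) (?g j) \<otimes> b (?g j) (f k))"
      using fin g fik a b gJ carr by (intro add.finprod_mono_neutral_cong_right) auto
    also have "\<dots> = (\<Oplus>j\<in>J. a (f i) (?g (g j)) \<otimes> b (?g (g j)) (f k))"
      using g fik a b gJ carr by (intro finsum_reindex) auto
    also have "\<dots> = (\<Oplus>j\<in>J. a (f i) j \<otimes> b j (f k))"
      using g fik a b carr by (intro finsum_cong') auto
    also have "\<dots> = (if i = k then \<one> else \<zero>)"
      using ab[OF fik] f ik by (simp add: inj_on_eq_iff)
    finally show "(\<Oplus>j\<in>J'. (if j \<in> g ` J then a (f i) (?g j) else \<zero>) \<otimes>
          (if j \<in> g ` J then b (?g j) (f k) else \<zero>)) = (if i = k then \<one> else \<zero>)" .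
  qed
qed


section \<open>Unbounded generating number in terms of matrices\<close>

lemma finsum_free_module_apply:
  assumes "finite F" and u: "u \<in> F \<rightarrow> carrier (free_module R I)" and i: "i \<in> I"
  shows "(\<Oplus>\<^bsub>free_module R I\<^esub>j\<in>F. u j) i = (\<Oplus>j\<in>F. u j i)"
proof -
  interpret M: right_module R "free_module R I"
    by (rule right_module_free_module) (rule ring_axioms)
  have cl: "v i \<in> carrier R" if "v \<in> carrier (free_module R I)" for v
    using that i by (auto simp: free_module_def)
  show ?thesis
    using \<open>finite F\<close> u
  proof (induction F rule: finite_induct)
    case empty
    show ?case using i M.M.finsum_empty[of u] by (simp add: free_module_def)
  next
    case (insert j F)
    then have u: "u j \<in> carrier (free_module R I)" "u \<in> F \<rightarrow> carrier (free_module R I)" by auto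
    then have "(\<Oplus>\<^bsub>free_module R I\<^esub>j\<in>insert j F. u j) =
        u j \<oplus>\<^bsub>free_module R I\<^esub> (\<Oplus>\<^bsub>free_module R I\<^esub>j\<in>F. u j)"
      using insert by (intro M.M.finsum_insert) auto
    then have "(\<Oplus>\<^bsub>free_module R I\<^esub>j\<in>insert j F. u j) i = u j i \<oplus> (\<Oplus>\<^bsub>free_module R I\<^esub>j\<in>F. u j) i"
      using i by (simp add: free_module_def)
    with insert u cl show ?case by (simp add: Pi_iff)
  qed
qed

text \<open>An epimorphism \<open>R\<^sup>J \<rightarrow> R\<^sup>I\<close> is given by a matrix, and the preimages of the unit vectors of
  \<open>R\<^sup>I\<close> form a right inverse of it.\<close>

lemma free_module_epi_iff:
  fixes I :: "'i set" and J :: "'j set"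
  assumes fin: "finite I" "finite J"
  shows "(\<exists>h. h \<in> mod_epi R (free_module R J) (free_module R I)) \<longleftrightarrow> free_retract R (carrier R) I J"
proof
  let ?I = "free_module R I" and ?J = "free_module R J"
  have carr_iff: "v \<in> carrier (free_module R K) \<longleftrightarrow> v \<in> K \<rightarrow>\<^sub>E carrier R" if "finite K" for v and K :: "'k set"
    using that by (simp add: free_module_def)
  have MI: "right_module R ?I" and MJ: "right_module R ?J"
    by (intro right_module_free_module ring_axioms)+
  {
    assume "\<exists>h. h \<in> mod_epi R ?J ?I"
    then obtain h where h: "h \<in> mod_hom R ?J ?I" and surj: "h ` carrier ?J = carrier ?I"
      by (auto simp: mod_epi_def)
    \<comment> \<open>\<open>e\<close> and \<open>e'\<close> are the unit vectors of the source and of the target.\<close>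
    define e :: "'j \<Rightarrow> 'j \<Rightarrow> 'a" where "e j = (\<lambda>i\<in>J. if i = j then \<one> else \<zero>)" for j
    define e' :: "'i \<Rightarrow> 'i \<Rightarrow> 'a" where "e' j = (\<lambda>i\<in>I. if i = j then \<one> else \<zero>)" for j
    have e: "e j \<in> carrier ?J" for j by (simp add: carr_iff fin e_def)
    have "e' j \<in> carrier ?I" for j by (simp add: carr_iff fin e'_def)
    then have "\<forall>k. \<exists>v\<in>carrier ?J. h v = e' k" using surj by (metis imageE)
    then obtain u where u: "\<And>k. u k \<in> carrier ?J" "\<And>k. h (u k) = e' k" by metis
    have uc: "u k j \<in> carrier R" if "j \<in> J" for j k
      using u(1)[of k] that by (auto simp: carr_iff fin)
    have hc: "h (e j) i \<in> carrier R" if "i \<in> I" for i j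
      using mod_homD(1)[OF h e, of j] that by (auto simp: carr_iff fin)
    have uk: "u k = (\<Oplus>\<^bsub>?J\<^esub>j\<in>J. u k j \<odot>\<^bsub>?J\<^esub> e j)" for k
    proof
      fix i
      have mem: "(\<lambda>j. u k j \<odot>\<^bsub>?J\<^esub> e j) \<in> J \<rightarrow> carrier ?J"
        using uc e right_module.smult_closed[OF MJ] by auto
      have "(\<Oplus>\<^bsub>?J\<^esub>j\<in>J. u k j \<odot>\<^bsub>?J\<^esub> e j) \<in> carrier ?J"
        using mem by (intro abelian_monoid.finsum_closed)
          (use MJ in \<open>auto simp: right_module_def abelian_group_def\<close>)
      then have ext: "(\<Oplus>\<^bsub>?J\<^esub>j\<in>J. u k j \<odot>\<^bsub>?J\<^esub> e j) \<in> extensional J" "u k \<in> extensional J"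
        using u(1)[of k] by (auto simp: carr_iff fin PiE_def)
      show "u k i = (\<Oplus>\<^bsub>?J\<^esub>j\<in>J. u k j \<odot>\<^bsub>?J\<^esub> e j) i"
      proof (cases "i \<in> J")
        case True
        have "(\<Oplus>\<^bsub>?J\<^esub>j\<in>J. u k j \<odot>\<^bsub>?J\<^esub> e j) i = (\<Oplus>j\<in>J. (u k j \<odot>\<^bsub>?J\<^esub> e j) i)"
          using mem True fin by (intro finsum_free_module_apply) auto
        also have "\<dots> = (\<Oplus>j\<in>J. if i = j then u k j else \<zero>)"
          using True uc by (intro finsum_cong') (auto simp: free_module_def e_def)
        also have "\<dots> = u k i"
          using True uc fin by (intro finsum_singleton) auto
        finally show ?thesis by simp
      next
        case False
        then show ?thesis using ext by (metis extensional_arb)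
      qed
    qed
    show "free_retract R (carrier R) I J"
    proof (rule free_retractI[of _ _ "\<lambda>i j. h (e j) i" _ "\<lambda>j k. u k j"])
      fix i k assume i: "i \<in> I" and k: "k \<in> I"
      have "e' k = h (\<Oplus>\<^bsub>?J\<^esub>j\<in>J. u k j \<odot>\<^bsub>?J\<^esub> e j)" using u(2) uk by metis
      also have "\<dots> = (\<Oplus>\<^bsub>?I\<^esub>j\<in>J. h (u k j \<odot>\<^bsub>?J\<^esub> e j))"
        using fin uc e right_module.smult_closed[OF MJ] by (intro mod_hom_finsum[OF MJ MI h]) auto
      finally have "e' k i = (\<Oplus>j\<in>J. h (u k j \<odot>\<^bsub>?J\<^esub> e j) i)"
        using fin i uc e right_module.smult_closed[OF MJ] mod_homD(1)[OF h]
        by (simp add: finsum_free_module_apply)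
      also have "\<dots> = (\<Oplus>j\<in>J. h (e j) i \<otimes> u k j)"
        using i uc hc e by (intro finsum_cong') (auto simp: mod_homD(3)[OF h], simp add: free_module_def)
      finally show "(\<Oplus>j\<in>J. h (e j) i \<otimes> u k j) = (if i = k then \<one> else \<zero>)"
        using i by (simp add: e'_def)
    qed (use uc hc in auto)
  next
    assume "free_retract R (carrier R) I J"
    then obtain a b where a: "\<And>i j. i \<in> I \<Longrightarrow> j \<in> J \<Longrightarrow> a i j \<in> carrier R"
      and b: "\<And>i j. i \<in> I \<Longrightarrow> j \<in> J \<Longrightarrow> b j i \<in> carrier R"
      and ab: "\<And>i k. i \<in> I \<Longrightarrow> k \<in> I \<Longrightarrow> (\<Oplus>j\<in>J. a i j \<otimes> b j k) = (if i = k then \<one> else \<zero>)"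
      by (rule free_retractE) blast
    define h where "h v = (\<lambda>i\<in>I. \<Oplus>j\<in>J. a i j \<otimes> v j)" for v
    have vc: "v j \<in> carrier R" if "v \<in> carrier ?J" "j \<in> J" for v j
      using that by (auto simp: carr_iff fin)
    have hcl: "h v \<in> carrier ?I" if "v \<in> carrier ?J" for v
      using vc[OF that] a by (auto simp: carr_iff fin h_def intro!: finsum_closed)
    have hom: "h \<in> mod_hom R ?J ?I"
    proof (rule mod_homI)
      fix v w assume v: "v \<in> carrier ?J" and w: "w \<in> carrier ?J"
      have "(\<Oplus>j\<in>J. a i j \<otimes> (v \<oplus>\<^bsub>?J\<^esub> w) j) = (\<Oplus>j\<in>J. a i j \<otimes> v j) \<oplus> (\<Oplus>j\<in>J. a i j \<otimes> w j)"
        if i: "i \<in> I" for i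
      proof -
        have "(\<Oplus>j\<in>J. a i j \<otimes> (v \<oplus>\<^bsub>?J\<^esub> w) j) = (\<Oplus>j\<in>J. a i j \<otimes> v j \<oplus> a i j \<otimes> w j)"
          using a[OF i] vc[OF v] vc[OF w]
          by (intro finsum_cong') (auto simp: free_module_def r_distr)
        also have "\<dots> = (\<Oplus>j\<in>J. a i j \<otimes> v j) \<oplus> (\<Oplus>j\<in>J. a i j \<otimes> w j)"
          using a[OF i] vc[OF v] vc[OF w] by (intro finsum_addf) auto
        finally show ?thesis .
      qed
      then show "h (v \<oplus>\<^bsub>?J\<^esub> w) = h v \<oplus>\<^bsub>?I\<^esub> h w"
        unfolding h_def by (auto simp: fun_eq_iff) (simp_all add: free_module_def)
    next
      fix r v assume r: "r \<in> carrier R" and v: "v \<in> carrier ?J"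
      have "(\<Oplus>j\<in>J. a i j \<otimes> (r \<odot>\<^bsub>?J\<^esub> v) j) = (\<Oplus>j\<in>J. a i j \<otimes> v j) \<otimes> r" if i: "i \<in> I" for i
      proof -
        have "(\<Oplus>j\<in>J. a i j \<otimes> (r \<odot>\<^bsub>?J\<^esub> v) j) = (\<Oplus>j\<in>J. (a i j \<otimes> v j) \<otimes> r)"
          using a[OF i] vc[OF v] r by (intro finsum_cong') (auto simp: free_module_def m_assoc)
        also have "\<dots> = (\<Oplus>j\<in>J. a i j \<otimes> v j) \<otimes> r"
          using a[OF i] vc[OF v] r fin by (intro finsum_ldistr[symmetric]) auto
        finally show ?thesis .
      qed
      then show "h (r \<odot>\<^bsub>?J\<^esub> v) = r \<odot>\<^bsub>?I\<^esub> h v"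
        unfolding h_def by (auto simp: fun_eq_iff) (simp_all add: free_module_def)
    qed (rule hcl)
    have "w \<in> h ` carrier ?J" if w: "w \<in> carrier ?I" for w
    proof
      have wc: "w i \<in> carrier R" if "i \<in> I" for i
        using w that by (auto simp: carr_iff fin)
      let ?v = "\<lambda>j\<in>J. \<Oplus>k\<in>I. b j k \<otimes> w k"
      show "?v \<in> carrier ?J"
        using b wc by (auto simp: carr_iff fin intro!: finsum_closed)
      have "(\<Oplus>j\<in>J. a i j \<otimes> ?v j) = w i" if i: "i \<in> I" for i
      proof -
        have "(\<Oplus>j\<in>J. a i j \<otimes> ?v j) = (\<Oplus>j\<in>J. a i j \<otimes> (\<Oplus>k\<in>I. b j k \<otimes> w k))"
          using i a b wc by (intro finsum_cong') (auto intro!: m_closed finsum_closed)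
        also have "\<dots> = (\<Oplus>k\<in>I. (\<Oplus>j\<in>J. a i j \<otimes> b j k) \<otimes> w k)"
          using i a b wc fin by (intro finsum_mult_assoc) auto
        also have "\<dots> = (\<Oplus>k\<in>I. if i = k then w k else \<zero>)"
          using i wc by (intro finsum_cong') (auto simp: ab)
        also have "\<dots> = w i"
          using i wc fin by (intro finsum_singleton) auto
        finally show ?thesis .
      qed
      then show "w = h ?v"
        using w by (auto simp: h_def fun_eq_iff carr_iff fin PiE_def extensional_def)
    qed
    then show "\<exists>h. h \<in> mod_epi R ?J ?I"
      using hom hcl by (auto simp: mod_epi_def)
  }
qed

lemma UGN_iff: "UGN R \<longleftrightarrow> \<not> (\<exists>n. free_retract R (carrier R) {..<Suc n} {..<n})"
proof -
  let ?P = "\<lambda>n::nat. free_retract R (carrier R) {..<Suc n} {..<n}"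
  have UGN: "UGN R \<longleftrightarrow> (\<forall>n>0. \<not> ?P n)"
    unfolding UGN_def using free_module_epi_iff[OF finite_lessThan finite_lessThan] by simp
  \<comment> \<open>\<open>UGN\<close> excludes \<open>n = 0\<close>; that case, which occurs only for the zero ring, reduces to \<open>n = 1\<close>.\<close>
  have "?P (Suc 0)" if "?P 0"
    using free_retract_insert[OF carrier_is_subring _ _ _ that, of 0 "Suc 0"]
    by (simp add: lessThan_Suc)
  then have "\<exists>k>0. ?P k" if "?P n" for n
    using that by (cases n) auto
  then show ?thesis unfolding UGN by blast
qed

end

lemma (in ring) UGN_subring_iff:
  assumes B: "subring B R"
  shows "UGN (R\<lparr>carrier := B\<rparr>) \<longleftrightarrow> \<not> (\<exists>n. free_retract R B {..<Suc n} {..<n})"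
  using ring.UGN_iff[OF subring_is_ring[OF B]] by (simp add: free_retract_subring[OF B])

section \<open>Opposite rings\<close>

lemma ring_opposite_ring:
  assumes "ring R" shows "ring (opposite_ring R)"
proof -
  interpret ring R by fact
  show ?thesis
    by (rule ringI, rule abelian_groupI)
      (auto simp: opposite_ring_def a_ac m_assoc l_distr r_distr
        intro: l_neg a_inv_closed intro!: monoidI bexI[of _ "\<ominus>\<^bsub>R\<^esub> _"])
qed

lemma opposite_ring_carrier_update:
  "(opposite_ring R)\<lparr>carrier := B\<rparr> = opposite_ring (R\<lparr>carrier := B\<rparr>)"
  by (simp add: opposite_ring_def)

lemma subring_opposite_ring:
  assumes "ring R" "subring B R"
  shows "subring B (opposite_ring R)"
proof -
  interpret Q: ring "opposite_ring R" by (rule ring_opposite_ring) fact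
  have "ring (R\<lparr>carrier := B\<rparr>)" using assms by (rule ring.subring_is_ring)
  then have "ring ((opposite_ring R)\<lparr>carrier := B\<rparr>)"
    unfolding opposite_ring_carrier_update by (rule ring_opposite_ring)
  moreover have "B \<subseteq> carrier (opposite_ring R)"
    using subringE(1)[OF assms(2)] by (simp add: opposite_ring_def)
  ultimately show ?thesis by (simp add: Q.subring_iff)
qed

lemma finsum_opposite_ring: "finsum (opposite_ring R) f F = finsum R f F"
  by (simp add: finsum_def opposite_ring_def)

lemma left_mult_module_eq: "left_mult_module R B = right_mult_module (opposite_ring R) B"
  by (simp add: left_mult_module_def right_mult_module_def opposite_ring_def)


section \<open>Right spans\<close>

text \<open>The right \<open>T\<close>-submodule of \<open>R\<close> spanned by a finite set \<open>X\<close>.\<close>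

definition right_span :: "('a, 'm) ring_scheme \<Rightarrow> 'a set \<Rightarrow> 'a set \<Rightarrow> 'a set"
  where "right_span R T X = {\<Oplus>\<^bsub>R\<^esub>x\<in>X. x \<otimes>\<^bsub>R\<^esub> c x | c. c \<in> X \<rightarrow> T}"

context ring
begin

context
  fixes T X
  assumes T: "subring T R" and X: "finite X" "X \<subseteq> carrier R"
begin

lemma right_span_carrier: "right_span R T X \<subseteq> carrier R"
  using X subring_carrier[OF T] by (auto simp: right_span_def Pi_iff intro!: finsum_closed)

lemma right_span_zero: "\<zero> \<in> right_span R T X"
proof -
  have "(\<Oplus>x\<in>X. x \<otimes> \<zero>) = (\<Oplus>x\<in>X. \<zero>)"
    using X by (intro finsum_cong') auto
  then have "\<zero> = (\<Oplus>x\<in>X. x \<otimes> \<zero>)" by simp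
  then show ?thesis
    unfolding right_span_def using subringE(2)[OF T]
    by (intro CollectI exI[of _ "\<lambda>_. \<zero>"]) auto
qed

lemma right_span_add:
  assumes "u \<in> right_span R T X" "v \<in> right_span R T X"
  shows "u \<oplus> v \<in> right_span R T X"
proof -
  obtain c d where c: "c \<in> X \<rightarrow> T" "u = (\<Oplus>x\<in>X. x \<otimes> c x)"
    and d: "d \<in> X \<rightarrow> T" "v = (\<Oplus>x\<in>X. x \<otimes> d x)"
    using assms by (auto simp: right_span_def)
  have cc: "c x \<in> carrier R" "d x \<in> carrier R" if "x \<in> X" for x
    using that c d subring_carrier[OF T] by auto
  have "u \<oplus> v = (\<Oplus>x\<in>X. x \<otimes> c x \<oplus> x \<otimes> d x)"
    unfolding c d using cc X by (intro finsum_addf[symmetric]) auto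
  also have "\<dots> = (\<Oplus>x\<in>X. x \<otimes> (c x \<oplus> d x))"
    using cc X by (intro finsum_cong') (auto simp: r_distr)
  finally show ?thesis
    unfolding right_span_def using c d subringE(7)[OF T]
    by (intro CollectI exI[of _ "\<lambda>x. c x \<oplus> d x"]) auto
qed

lemma right_span_mult:
  assumes "u \<in> right_span R T X" "r \<in> T"
  shows "u \<otimes> r \<in> right_span R T X"
proof -
  obtain c where c: "c \<in> X \<rightarrow> T" "u = (\<Oplus>x\<in>X. x \<otimes> c x)"
    using assms by (auto simp: right_span_def)
  have cc: "c x \<in> carrier R" if "x \<in> X" for x
    using that c subring_carrier[OF T] by auto
  have r: "r \<in> carrier R" using assms subring_carrier[OF T] by auto
  have "u \<otimes> r = (\<Oplus>x\<in>X. x \<otimes> c x \<otimes> r)"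
    unfolding c using cc X r by (intro finsum_ldistr) auto
  also have "\<dots> = (\<Oplus>x\<in>X. x \<otimes> (c x \<otimes> r))"
    using cc X r by (intro finsum_cong') (auto simp: m_assoc)
  finally show ?thesis
    unfolding right_span_def using c assms(2) subringE(6)[OF T]
    by (intro CollectI exI[of _ "\<lambda>x. c x \<otimes> r"]) auto
qed

lemma right_span_generator:
  assumes y: "y \<in> X"
  shows "y \<in> right_span R T X"
proof -
  have "(\<Oplus>x\<in>X. x \<otimes> (if y = x then \<one> else \<zero>)) = (\<Oplus>x\<in>X. if y = x then x else \<zero>)"
    using X by (intro finsum_cong') auto
  also have "\<dots> = y"
    using X y by (intro finsum_singleton) auto
  finally show ?thesis
    unfolding right_span_def using subringE(2,3)[OF T]
    by (intro CollectI exI[of _ "\<lambda>x. if y = x then \<one> else \<zero>"]) auto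
qed

lemma right_span_finsum:
  assumes "f \<in> F \<rightarrow> right_span R T X"
  shows "(\<Oplus>i\<in>F. f i) \<in> right_span R T X"
  using assms
proof (induction F rule: infinite_finite_induct)
  case (insert i F)
  then have "f \<in> F \<rightarrow> carrier R" "f i \<in> carrier R"
    using right_span_carrier by auto
  with insert show ?case by (simp add: right_span_add Pi_iff)
qed (simp_all add: right_span_zero)

lemma right_span_least:
  assumes "\<zero> \<in> H" "\<And>u v. u \<in> H \<Longrightarrow> v \<in> H \<Longrightarrow> u \<oplus> v \<in> H"
    and "\<And>u r. u \<in> H \<Longrightarrow> r \<in> T \<Longrightarrow> u \<otimes> r \<in> H" and XH: "X \<subseteq> H"
  shows "right_span R T X \<subseteq> H"
proof
  fix u assume "u \<in> right_span R T X"
  then obtain c where c: "c \<in> X \<rightarrow> T" and u: "u = (\<Oplus>x\<in>X. x \<otimes> c x)"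
    by (auto simp: right_span_def)
  have "(\<Oplus>x\<in>F. x \<otimes> c x) \<in> H" if "finite F" "F \<subseteq> X" for F
    using that
  proof (induction F rule: finite_induct)
    case (insert x F)
    then have "(\<lambda>x. x \<otimes> c x) \<in> F \<rightarrow> carrier R" "x \<otimes> c x \<in> carrier R"
      using X c subring_carrier[OF T] by (auto simp: Pi_iff subset_iff)
    moreover have "x \<otimes> c x \<in> H" using insert c XH assms(3) by auto
    ultimately show ?case using insert assms(2) by simp
  qed (simp add: assms(1))
  then show "u \<in> H" using u X by blast
qed

end

lemma right_span_mono:
  assumes T: "subring T R" and Y: "finite Y" "Y \<subseteq> carrier R" and XY: "X \<subseteq> Y"
  shows "right_span R T X \<subseteq> right_span R T Y"
proof (rule right_span_least[OF T])
  show "finite X" by (rule finite_subset[OF XY Y(1)])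
  show "X \<subseteq> carrier R" "X \<subseteq> right_span R T Y"
    using XY Y right_span_generator[OF T Y] by auto
qed (use right_span_zero[OF T Y] right_span_add[OF T Y] right_span_mult[OF T Y] in auto)

text \<open>Finite generation, phrased through submodules, yields explicit linear combinations.\<close>

lemma right_span_of_fin_gen_module:
  assumes T: "subring T R" and B: "B \<subseteq> carrier R"
    and M: "right_module (R\<lparr>carrier := T\<rparr>) (right_mult_module R B)"
    and fg: "fin_gen_module (R\<lparr>carrier := T\<rparr>) (right_mult_module R B)"
  obtains X where "finite X" "X \<subseteq> B" "B \<subseteq> right_span R T X"
proof -
  let ?M = "right_mult_module R B"
  interpret M: right_module "R\<lparr>carrier := T\<rparr>" ?M by fact
  have simps: "carrier ?M = B" "add ?M = add R" "zero ?M = \<zero>" "\<And>r x. r \<odot>\<^bsub>?M\<^esub> x = x \<otimes> r"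
    by (simp_all add: right_mult_module_def)
  obtain X where X: "finite X" "X \<subseteq> B"
    and gen: "\<And>H. submodule H (R\<lparr>carrier := T\<rparr>) ?M \<Longrightarrow> X \<subseteq> H \<Longrightarrow> H = B"
    using fg unfolding fin_gen_module_def simps by blast
  have XR: "X \<subseteq> carrier R" using X B by blast
  have sub: "right_span R T X \<subseteq> B"
  proof (rule right_span_least[OF T X(1) XR])
    show "\<zero> \<in> B" using M.M.zero_closed by (simp add: simps)
    show "u \<oplus> v \<in> B" if "u \<in> B" "v \<in> B" for u v
      using M.M.a_closed[of u v] that by (simp add: simps)
    show "u \<otimes> r \<in> B" if "u \<in> B" "r \<in> T" for u r
      using M.smult_closed[of r u] that by (simp add: simps)
  qed (rule X)
  have neg: "\<ominus>\<^bsub>?M\<^esub> u \<in> right_span R T X" if u: "u \<in> right_span R T X" for u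
  proof -
    have m1: "\<ominus> \<one> \<in> T" using subringE(3,5)[OF T] by blast
    have uR: "u \<in> carrier R" using u right_span_carrier[OF T X(1) XR] by blast
    have u1: "u \<otimes> \<ominus> \<one> \<in> right_span R T X"
      using right_span_mult[OF T X(1) XR u m1] .
    have "u \<otimes> \<ominus> \<one> \<oplus> u = \<zero>" using uR by (simp add: r_minus l_neg)
    then have "\<ominus>\<^bsub>?M\<^esub> u = u \<otimes> \<ominus> \<one>"
      using u u1 sub by (intro M.M.minus_equality) (auto simp: simps)
    then show ?thesis using u1 by simp
  qed
  have "submodule (right_span R T X) (R\<lparr>carrier := T\<rparr>) ?M"
  proof (intro submodule.intro subgroup.intro submodule_axioms.intro)
    show "right_span R T X \<subseteq> carrier (add_monoid ?M)" using sub by (simp add: simps)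
    show "inv\<^bsub>add_monoid ?M\<^esub> u \<in> right_span R T X" if "u \<in> right_span R T X" for u
      using neg[OF that] by (simp add: a_inv_def)
  qed (use right_span_zero[OF T X(1) XR] right_span_add[OF T X(1) XR]
      right_span_mult[OF T X(1) XR] in \<open>auto simp: simps\<close>)
  then have "right_span R T X = B"
    using right_span_generator[OF T X(1) XR] by (intro gen) auto
  then show ?thesis using X that by blast
qed


section \<open>Descent along a retraction\<close>

text \<open>
  Let \<open>S\<close> be a subring that lies in the right \<open>T\<close>-span of a finite set, and let \<open>p\<close> be a map from
  \<open>R\<close> to \<open>T\<close> that is right \<open>T\<close>-linear and fixes \<open>1\<close>.  If unbounded generating number fails for \<open>S\<close>, then it
  fails for \<open>T\<close>.
\<close>

lemma free_retract_descends:
  assumes S: "subring S R" and T: "subring T R"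
    and pT: "\<And>x. x \<in> carrier R \<Longrightarrow> p x \<in> T"
    and padd: "\<And>x y. x \<in> carrier R \<Longrightarrow> y \<in> carrier R \<Longrightarrow> p (x \<oplus> y) = p x \<oplus> p y"
    and pmult: "\<And>x r. x \<in> carrier R \<Longrightarrow> r \<in> T \<Longrightarrow> p (x \<otimes> r) = p x \<otimes> r"
    and p1: "p \<one> = \<one>"
    and X: "finite X" "X \<subseteq> carrier R" "S \<subseteq> right_span R T X"
    and nU: "free_retract R S {..<Suc n} {..<n}"
  shows "\<exists>m. free_retract R T {..<Suc m} {..<m}"
proof -
  note Sc = subring_carrier[OF S] and Tc = subring_carrier[OF T]
  have Xc: "x \<in> carrier R" if "x \<in> X" for x using X that by blast
  have p0: "p \<zero> = \<zero>" by (rule additive_zero) (use pT Tc padd in auto)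
  let ?J = "{..<n} \<times> X"
  let ?N = "Suc (card ?J)"
  \<comment> \<open>Over \<open>T\<close> the source will have rank \<open>card ?J\<close>, whatever the rank of the target; a target of
      rank \<open>n + ?N\<close> exceeds it.\<close>
  have "free_retract R S {..<n + ?N} {..<n}"
    by (rule free_retract_iterate[OF S nU])
  then obtain a b where a: "\<And>i j. i < n + ?N \<Longrightarrow> j < n \<Longrightarrow> a i j \<in> S"
    and b: "\<And>i j. i < n + ?N \<Longrightarrow> j < n \<Longrightarrow> b j i \<in> S"
    and ab: "\<And>i k. i < n + ?N \<Longrightarrow> k < n + ?N \<Longrightarrow>
      (\<Oplus>j\<in>{..<n}. a i j \<otimes> b j k) = (if i = k then \<one> else \<zero>)"
    by (rule free_retractE) (auto simp del: card_cartesian_product)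
  have ex: "\<exists>c. c \<in> X \<rightarrow> T \<and> b j k = (\<Oplus>x\<in>X. x \<otimes> c x)" if "k < n + ?N" "j < n" for j k
    using X(3) b[OF that] by (auto simp: right_span_def)
  define c where "c j k = (SOME c. c \<in> X \<rightarrow> T \<and> b j k = (\<Oplus>x\<in>X. x \<otimes> c x))" for j k
  have cprops: "c j k \<in> X \<rightarrow> T \<and> b j k = (\<Oplus>x\<in>X. x \<otimes> c j k x)" if "k < n + ?N" "j < n" for j k
    unfolding c_def by (rule someI_ex[OF ex[OF that]])
  then have c: "\<And>j k x. k < n + ?N \<Longrightarrow> j < n \<Longrightarrow> x \<in> X \<Longrightarrow> c j k x \<in> T"
    and bc: "\<And>j k. k < n + ?N \<Longrightarrow> j < n \<Longrightarrow> b j k = (\<Oplus>x\<in>X. x \<otimes> c j k x)"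
    by blast+
  have "free_retract R T {..<n + ?N} ?J"
  proof (rule free_retractI)
    fix i y assume i: "i \<in> {..<n + ?N}" and y: "y \<in> ?J"
    show "(case y of (j, x) \<Rightarrow> p (a i j \<otimes> x)) \<in> T"
      using i y a Sc Xc by (auto intro!: pT simp del: card_cartesian_product)
    show "(case y of (j, x) \<Rightarrow> c j i x) \<in> T"
      using i y c by (auto simp del: card_cartesian_product)
  next
    fix i k assume "i \<in> {..<n + ?N}" and "k \<in> {..<n + ?N}"
    then have i: "i < n + ?N" and k: "k < n + ?N" by simp_all
    have ac: "a i j \<in> carrier R" and cc: "x \<in> X \<Longrightarrow> c j k x \<in> carrier R" if "j < n" for j x
      using a[OF i that] c[OF k that] Sc Tc by auto
    have "(\<Oplus>y\<in>?J. (case y of (j, x) \<Rightarrow> p (a i j \<otimes> x)) \<otimes> (case y of (j, x) \<Rightarrow> c j k x)) =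
        (\<Oplus>j\<in>{..<n}. \<Oplus>x\<in>X. p (a i j \<otimes> x) \<otimes> c j k x)"
      using X ac cc Xc Tc pT by (subst finsum_Times) auto
    also have "\<dots> = (\<Oplus>j\<in>{..<n}. p (a i j \<otimes> b j k))"
    proof (rule finsum_cong')
      fix j assume "j \<in> {..<n}"
      then have j: "j < n" by simp
      have "a i j \<otimes> b j k = (\<Oplus>x\<in>X. a i j \<otimes> (x \<otimes> c j k x))"
        unfolding bc[OF k j] using X ac[OF j] cc[OF j] Xc by (intro finsum_rdistr) auto
      also have "\<dots> = (\<Oplus>x\<in>X. (a i j \<otimes> x) \<otimes> c j k x)"
        using ac[OF j] cc[OF j] Xc by (intro finsum_cong') (auto simp: m_assoc)
      also have "p \<dots> = (\<Oplus>x\<in>X. p ((a i j \<otimes> x) \<otimes> c j k x))"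
        using ac[OF j] cc[OF j] Xc pT Tc padd by (intro additive_finsum) auto
      also have "\<dots> = (\<Oplus>x\<in>X. p (a i j \<otimes> x) \<otimes> c j k x)"
        using ac[OF j] cc[OF j] c[OF k j] Xc pT Tc by (intro finsum_cong') (auto simp: pmult)
      finally show "(\<Oplus>x\<in>X. p (a i j \<otimes> x) \<otimes> c j k x) = p (a i j \<otimes> b j k)" ..
    qed (use ac b[OF k] Sc pT Tc in auto)
    also have "\<dots> = p (\<Oplus>j\<in>{..<n}. a i j \<otimes> b j k)"
      using ac b[OF k] Sc pT Tc padd by (intro additive_finsum[symmetric]) auto
    also have "\<dots> = (if i = k then \<one> else \<zero>)"
      by (simp add: ab[OF i k] p0 p1)
    finally show "(\<Oplus>y\<in>?J. (case y of (j, x) \<Rightarrow> p (a i j \<otimes> x)) \<otimes> (case y of (j, x) \<Rightarrow> c j k x)) =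
        (if i = k then \<one> else \<zero>)" .
  qed
  then have "free_retract R T {..<?N} {..<card ?J}"
    by (rule free_retract_card[OF T]) (use X in auto)
  then show ?thesis by blast
qed

end


section \<open>Homogeneous components\<close>

context graded_ring
begin

text \<open>The family of homogeneous components of an element of \<open>R\<close>.\<close>

definition components :: "'a \<Rightarrow> 'g \<Rightarrow> 'a"
  where "components x = (THE f. f \<in> (\<Pi>\<^sub>E g\<in>carrier G. A g) \<and> finite {g \<in> carrier G. f g \<noteq> \<zero>\<^bsub>R\<^esub>} \<and>
    x = (\<Oplus>\<^bsub>R\<^esub>g\<in>{g \<in> carrier G. f g \<noteq> \<zero>\<^bsub>R\<^esub>}. f g))"

lemma components_props:
  assumes "x \<in> carrier R"
  shows "components x \<in> (\<Pi>\<^sub>E g\<in>carrier G. A g)"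
    and "finite {g \<in> carrier G. components x g \<noteq> \<zero>\<^bsub>R\<^esub>}"
    and "(\<Oplus>\<^bsub>R\<^esub>g\<in>{g \<in> carrier G. components x g \<noteq> \<zero>\<^bsub>R\<^esub>}. components x g) = x"
  using theI'[OF direct_sum[OF assms]] unfolding components_def[symmetric] by auto

lemma components_mem: "x \<in> carrier R \<Longrightarrow> g \<in> carrier G \<Longrightarrow> components x g \<in> A g"
  using components_props(1) by (auto simp: PiE_iff)

lemma components_carrier: "x \<in> carrier R \<Longrightarrow> g \<in> carrier G \<Longrightarrow> components x g \<in> carrier R"
  using components_mem component_carrier by blast

lemma components_eqI:
  assumes f: "f \<in> (\<Pi>\<^sub>E g\<in>carrier G. A g)" and F: "finite F" "F \<subseteq> carrier G"
    and supp: "\<And>g. g \<in> carrier G - F \<Longrightarrow> f g = \<zero>\<^bsub>R\<^esub>" and x: "x = (\<Oplus>\<^bsub>R\<^esub>g\<in>F. f g)"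
  shows "components x = f"
proof -
  have sub: "{g \<in> carrier G. f g \<noteq> \<zero>\<^bsub>R\<^esub>} \<subseteq> F" using supp by blast
  have fc: "f g \<in> carrier R" if "g \<in> carrier G" for g
    using f that component_carrier by (auto simp: PiE_iff)
  have "x = (\<Oplus>\<^bsub>R\<^esub>g\<in>{g \<in> carrier G. f g \<noteq> \<zero>\<^bsub>R\<^esub>}. f g)"
    unfolding x using F sub fc by (intro R.add.finprod_mono_neutral_cong_right) auto
  moreover from this have "x \<in> carrier R" using fc by (auto intro!: R.finsum_closed)
  ultimately show ?thesis
    using components_props f finite_subset[OF sub F(1)] by (intro family_unique) auto
qed

lemma finsum_components:
  assumes x: "x \<in> carrier R" and F: "finite F" "F \<subseteq> carrier G"
    and supp: "\<And>g. g \<in> carrier G - F \<Longrightarrow> components x g = \<zero>\<^bsub>R\<^esub>"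
  shows "(\<Oplus>\<^bsub>R\<^esub>g\<in>F. components x g) = x"
proof -
  have "(\<Oplus>\<^bsub>R\<^esub>g\<in>F. components x g) =
      (\<Oplus>\<^bsub>R\<^esub>g\<in>{g \<in> carrier G. components x g \<noteq> \<zero>\<^bsub>R\<^esub>}. components x g)"
    using F supp components_carrier[OF x] by (intro R.add.finprod_mono_neutral_cong_right) auto
  then show ?thesis using components_props(3)[OF x] by simp
qed

lemma components_add:
  assumes x: "x \<in> carrier R" and y: "y \<in> carrier R"
  shows "components (x \<oplus>\<^bsub>R\<^esub> y) = (\<lambda>g\<in>carrier G. components x g \<oplus>\<^bsub>R\<^esub> components y g)"
proof (rule components_eqI)
  let ?F = "\<lambda>x. {g \<in> carrier G. components x g \<noteq> \<zero>\<^bsub>R\<^esub>}"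
  show fin: "finite (?F x \<union> ?F y)" and "?F x \<union> ?F y \<subseteq> carrier G"
    using components_props(2) x y by auto
  have "(\<Oplus>\<^bsub>R\<^esub>g\<in>?F x \<union> ?F y. (\<lambda>g\<in>carrier G. components x g \<oplus>\<^bsub>R\<^esub> components y g) g) =
      (\<Oplus>\<^bsub>R\<^esub>g\<in>?F x \<union> ?F y. components x g \<oplus>\<^bsub>R\<^esub> components y g)"
    using components_carrier x y by (intro R.finsum_cong') auto
  also have "\<dots> = (\<Oplus>\<^bsub>R\<^esub>g\<in>?F x \<union> ?F y. components x g) \<oplus>\<^bsub>R\<^esub> (\<Oplus>\<^bsub>R\<^esub>g\<in>?F x \<union> ?F y. components y g)"
    using components_carrier x y by (intro R.finsum_addf) auto
  also have "(\<Oplus>\<^bsub>R\<^esub>g\<in>?F x \<union> ?F y. components x g) = x"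
    by (rule finsum_components[OF x fin]) auto
  also have "(\<Oplus>\<^bsub>R\<^esub>g\<in>?F x \<union> ?F y. components y g) = y"
    by (rule finsum_components[OF y fin]) auto
  finally show "x \<oplus>\<^bsub>R\<^esub> y =
      (\<Oplus>\<^bsub>R\<^esub>g\<in>?F x \<union> ?F y. (\<lambda>g\<in>carrier G. components x g \<oplus>\<^bsub>R\<^esub> components y g) g)" ..
qed (use components_mem x y component_subgroup in
    \<open>auto simp: additive_subgroup.a_closed\<close>)

lemma components_homogeneous:
  assumes g: "g \<in> carrier G" and x: "x \<in> A g"
  shows "components x = (\<lambda>k\<in>carrier G. if g = k then x else \<zero>\<^bsub>R\<^esub>)"
proof (rule components_eqI[of _ "{g}"])
  show "x = (\<Oplus>\<^bsub>R\<^esub>k\<in>{g}. (\<lambda>k\<in>carrier G. if g = k then x else \<zero>\<^bsub>R\<^esub>) k)"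
    using g x component_carrier by simp
qed (use g x component_zero in auto)

lemma components_mult_right:
  assumes x: "x \<in> carrier R" and r: "r \<in> A \<one>\<^bsub>G\<^esub>"
  shows "components (x \<otimes>\<^bsub>R\<^esub> r) = (\<lambda>g\<in>carrier G. components x g \<otimes>\<^bsub>R\<^esub> r)"
proof (rule components_eqI)
  let ?F = "{g \<in> carrier G. components x g \<noteq> \<zero>\<^bsub>R\<^esub>}"
  have rc: "r \<in> carrier R" using component_carrier[OF _ r] by simp
  show "finite ?F" "?F \<subseteq> carrier G" using components_props(2)[OF x] by auto
  have "x \<otimes>\<^bsub>R\<^esub> r = (\<Oplus>\<^bsub>R\<^esub>g\<in>?F. components x g) \<otimes>\<^bsub>R\<^esub> r"
    by (simp only: components_props(3)[OF x])
  also have "\<dots> = (\<Oplus>\<^bsub>R\<^esub>g\<in>?F. components x g \<otimes>\<^bsub>R\<^esub> r)"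
    using components_props(2)[OF x] components_carrier[OF x] rc by (intro R.finsum_ldistr) auto
  also have "\<dots> = (\<Oplus>\<^bsub>R\<^esub>g\<in>?F. (\<lambda>g\<in>carrier G. components x g \<otimes>\<^bsub>R\<^esub> r) g)"
    using components_carrier[OF x] rc by (intro R.finsum_cong') auto
  finally show "x \<otimes>\<^bsub>R\<^esub> r = (\<Oplus>\<^bsub>R\<^esub>g\<in>?F. (\<lambda>g\<in>carrier G. components x g \<otimes>\<^bsub>R\<^esub> r) g)" .
  show "(\<lambda>g\<in>carrier G. components x g \<otimes>\<^bsub>R\<^esub> r) \<in> (\<Pi>\<^sub>E g\<in>carrier G. A g)"
    using component_mult[OF _ G.one_closed components_mem[OF x] r] by auto
  show "(\<lambda>g\<in>carrier G. components x g \<otimes>\<^bsub>R\<^esub> r) g = \<zero>\<^bsub>R\<^esub>" if "g \<in> carrier G - ?F" for g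
    using that rc by auto
qed

lemma components_mult_left:
  assumes x: "x \<in> carrier R" and r: "r \<in> A \<one>\<^bsub>G\<^esub>"
  shows "components (r \<otimes>\<^bsub>R\<^esub> x) = (\<lambda>g\<in>carrier G. r \<otimes>\<^bsub>R\<^esub> components x g)"
proof (rule components_eqI)
  let ?F = "{g \<in> carrier G. components x g \<noteq> \<zero>\<^bsub>R\<^esub>}"
  have rc: "r \<in> carrier R" using component_carrier[OF _ r] by simp
  show "finite ?F" "?F \<subseteq> carrier G" using components_props(2)[OF x] by auto
  have "r \<otimes>\<^bsub>R\<^esub> x = r \<otimes>\<^bsub>R\<^esub> (\<Oplus>\<^bsub>R\<^esub>g\<in>?F. components x g)"
    by (simp only: components_props(3)[OF x])
  also have "\<dots> = (\<Oplus>\<^bsub>R\<^esub>g\<in>?F. r \<otimes>\<^bsub>R\<^esub> components x g)"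
    using components_props(2)[OF x] components_carrier[OF x] rc by (intro R.finsum_rdistr) auto
  also have "\<dots> = (\<Oplus>\<^bsub>R\<^esub>g\<in>?F. (\<lambda>g\<in>carrier G. r \<otimes>\<^bsub>R\<^esub> components x g) g)"
    using components_carrier[OF x] rc by (intro R.finsum_cong') auto
  finally show "r \<otimes>\<^bsub>R\<^esub> x = (\<Oplus>\<^bsub>R\<^esub>g\<in>?F. (\<lambda>g\<in>carrier G. r \<otimes>\<^bsub>R\<^esub> components x g) g)" .
  show "(\<lambda>g\<in>carrier G. r \<otimes>\<^bsub>R\<^esub> components x g) \<in> (\<Pi>\<^sub>E g\<in>carrier G. A g)"
    using component_mult[OF G.one_closed _ r components_mem[OF x]] by auto
  show "(\<lambda>g\<in>carrier G. r \<otimes>\<^bsub>R\<^esub> components x g) g = \<zero>\<^bsub>R\<^esub>" if "g \<in> carrier G - ?F" for g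
    using that rc by auto
qed


section \<open>The subring supported on a finite subgroup\<close>

text \<open>The elements of \<open>R\<close> all of whose nonzero components have degree in \<open>H\<close>.\<close>

definition supported_on :: "'g set \<Rightarrow> 'a set"
  where "supported_on H = {x \<in> carrier R. \<forall>g\<in>carrier G - H. components x g = \<zero>\<^bsub>R\<^esub>}"

lemma supported_on_homogeneous:
  assumes "g \<in> carrier G" "g \<in> H" "x \<in> A g"
  shows "x \<in> supported_on H"
  using assms component_carrier by (auto simp: supported_on_def components_homogeneous)

lemma supported_on_finsum:
  assumes f: "f \<in> F \<rightarrow> supported_on H"
  shows "(\<Oplus>\<^bsub>R\<^esub>i\<in>F. f i) \<in> supported_on H"
  using f
proof (induction F rule: infinite_finite_induct)
  case (insert i F)
  then have "f i \<in> carrier R" "f \<in> F \<rightarrow> carrier R" by (auto simp: supported_on_def)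
  with insert show ?case by (auto simp: supported_on_def components_add)
qed (auto simp: supported_on_def components_homogeneous[OF G.one_closed component_zero])

lemma subring_supported_on:
  assumes H: "subgroup H G" "finite H"
  shows "subring (supported_on H) R"
proof (rule R.subringI)
  have HG: "H \<subseteq> carrier G" using H by (simp add: subgroup.subset)
  show "supported_on H \<subseteq> carrier R" by (auto simp: supported_on_def)
  show "\<one>\<^bsub>R\<^esub> \<in> supported_on H"
    using subgroup.one_closed[OF H(1)] one_in_base by (intro supported_on_homogeneous) auto
  show "\<ominus>\<^bsub>R\<^esub> x \<in> supported_on H" if x: "x \<in> supported_on H" for x
  proof -
    have xc: "x \<in> carrier R" using x by (simp add: supported_on_def)
    have m: "\<ominus>\<^bsub>R\<^esub> \<one>\<^bsub>R\<^esub> \<in> A \<one>\<^bsub>G\<^esub>" using subringE(3,5)[OF base_subring] by blast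
    have "x \<otimes>\<^bsub>R\<^esub> \<ominus>\<^bsub>R\<^esub> \<one>\<^bsub>R\<^esub> \<in> supported_on H"
      using x xc by (auto simp: supported_on_def components_mult_right[OF xc m])
    then show ?thesis using xc by (simp add: R.r_minus)
  qed
  show "x \<oplus>\<^bsub>R\<^esub> y \<in> supported_on H" if "x \<in> supported_on H" "y \<in> supported_on H" for x y
    using that by (auto simp: supported_on_def components_add)
  show "x \<otimes>\<^bsub>R\<^esub> y \<in> supported_on H" if x: "x \<in> supported_on H" and y: "y \<in> supported_on H" for x y
  proof -
    have xc: "x \<in> carrier R" and yc: "y \<in> carrier R" using x y by (auto simp: supported_on_def)
    have cx: "components x g \<in> carrier R" and cy: "components y g \<in> carrier R" if "g \<in> H" for g
      using that HG components_carrier xc yc by auto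
    have "x \<otimes>\<^bsub>R\<^esub> y = (\<Oplus>\<^bsub>R\<^esub>g\<in>H. components x g) \<otimes>\<^bsub>R\<^esub> y"
      using x finsum_components[OF xc H(2) HG] by (simp add: supported_on_def)
    also have "\<dots> = (\<Oplus>\<^bsub>R\<^esub>g\<in>H. components x g \<otimes>\<^bsub>R\<^esub> y)"
      using H cx yc by (intro R.finsum_ldistr) auto
    also have "\<dots> \<in> supported_on H"
    proof (intro supported_on_finsum Pi_I)
      fix g assume g: "g \<in> H"
      have "components x g \<otimes>\<^bsub>R\<^esub> y = components x g \<otimes>\<^bsub>R\<^esub> (\<Oplus>\<^bsub>R\<^esub>h\<in>H. components y h)"
        using y finsum_components[OF yc H(2) HG] by (simp add: supported_on_def)
      also have "\<dots> = (\<Oplus>\<^bsub>R\<^esub>h\<in>H. components x g \<otimes>\<^bsub>R\<^esub> components y h)"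
        using H cx[OF g] cy by (intro R.finsum_rdistr) auto
      also have "\<dots> \<in> supported_on H"
      proof (intro supported_on_finsum Pi_I)
        fix h assume h: "h \<in> H"
        have "components x g \<otimes>\<^bsub>R\<^esub> components y h \<in> A (g \<otimes>\<^bsub>G\<^esub> h)"
          using g h HG components_mem[OF xc] components_mem[OF yc] by (intro component_mult) auto
        then show "components x g \<otimes>\<^bsub>R\<^esub> components y h \<in> supported_on H"
          using g h HG subgroup.m_closed[OF H(1) g h]
          by (intro supported_on_homogeneous[of "g \<otimes>\<^bsub>G\<^esub> h"]) auto
      qed
      finally show "components x g \<otimes>\<^bsub>R\<^esub> y \<in> supported_on H" .
    qed
    finally show ?thesis .
  qed
qed

text \<open>The ring \<open>Q\<close> stands for \<open>R\<close> or its opposite, to serve right and left module structures alike.\<close>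

lemma supported_on_in_right_span:
  assumes Q: "ring Q" "carrier Q = carrier R" "\<And>f F. finsum Q f F = (\<Oplus>\<^bsub>R\<^esub>g\<in>(F :: 'g set). f g)"
    and T: "subring T Q"
    and H: "finite H" "H \<subseteq> carrier G"
    and span: "\<And>g. g \<in> H \<Longrightarrow> \<exists>X. finite X \<and> X \<subseteq> A g \<and> A g \<subseteq> right_span Q T X"
  obtains X where "finite X" "X \<subseteq> carrier R" "supported_on H \<subseteq> right_span Q T X"
proof -
  interpret Q: ring Q by fact
  obtain X where X: "\<And>g. g \<in> H \<Longrightarrow> finite (X g)" "\<And>g. g \<in> H \<Longrightarrow> X g \<subseteq> A g"
    "\<And>g. g \<in> H \<Longrightarrow> A g \<subseteq> right_span Q T (X g)"
    using span by metis
  let ?X = "\<Union>g\<in>H. X g"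
  have fin: "finite ?X" using X H by blast
  have car: "?X \<subseteq> carrier R" using X H component_carrier by blast
  have "x \<in> right_span Q T ?X" if x: "x \<in> supported_on H" for x
  proof -
    have xc: "x \<in> carrier R" using x by (simp add: supported_on_def)
    have "x = (\<Oplus>\<^bsub>R\<^esub>g\<in>H. components x g)"
      using x finsum_components[OF xc H] by (simp add: supported_on_def)
    also have "\<dots> = (\<Oplus>\<^bsub>Q\<^esub>g\<in>H. components x g)" by (simp add: Q)
    also have "\<dots> \<in> right_span Q T ?X"
    proof (intro Q.right_span_finsum[OF T fin] Pi_I)
      fix g assume g: "g \<in> H"
      have "components x g \<in> A g" using g H components_mem[OF xc] by blast
      then have "components x g \<in> right_span Q T (X g)" using X g by blast
      then show "components x g \<in> right_span Q T ?X"
        using Q.right_span_mono[OF T fin, of "X g"] car g Q by blast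
    qed (use car Q in simp)
    finally show ?thesis .
  qed
  then show ?thesis using that fin car by blast
qed

text \<open>Here local finiteness enters: the degrees of the finitely many matrix entries generate \<open>H\<close>.\<close>

lemma free_retract_in_supported_on:
  assumes lf: "locally_finite_group G" and fin: "finite I" "finite J"
    and fr: "free_retract R (carrier R) I J"
  obtains H where "subgroup H G" "finite H" "free_retract R (supported_on H) I J"
proof -
  obtain a b where a: "\<And>i j. i \<in> I \<Longrightarrow> j \<in> J \<Longrightarrow> a i j \<in> carrier R"
    and b: "\<And>i j. i \<in> I \<Longrightarrow> j \<in> J \<Longrightarrow> b j i \<in> carrier R"
    and ab: "\<And>i k. i \<in> I \<Longrightarrow> k \<in> I \<Longrightarrow>
      (\<Oplus>\<^bsub>R\<^esub>j\<in>J. a i j \<otimes>\<^bsub>R\<^esub> b j k) = (if i = k then \<one>\<^bsub>R\<^esub> else \<zero>\<^bsub>R\<^esub>)"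
    using fr by (rule free_retractE) blast
  let ?F = "\<lambda>x. {g \<in> carrier G. components x g \<noteq> \<zero>\<^bsub>R\<^esub>}"
  define Y where "Y = (\<Union>i\<in>I. \<Union>j\<in>J. ?F (a i j) \<union> ?F (b j i))"
  have Y: "finite Y" "Y \<subseteq> carrier G"
  proof -
    have "finite (?F (a i j) \<union> ?F (b j i))" if "i \<in> I" "j \<in> J" for i j
      using components_props(2)[OF a[OF that]] components_props(2)[OF b[OF that]] by (rule finite_UnI)
    then show "finite Y" unfolding Y_def using fin by blast
    show "Y \<subseteq> carrier G" unfolding Y_def by blast
  qed
  have YH: "Y \<subseteq> generate G Y" by (auto intro: generate.incl)
  have ms: "x \<in> supported_on (generate G Y)" if "x \<in> carrier R" "?F x \<subseteq> Y" for x
    using that YH by (auto simp: supported_on_def)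
  show ?thesis
  proof
    show "subgroup (generate G Y) G" using Y by (intro G.generate_is_subgroup)
    show "finite (generate G Y)" using lf Y by (auto simp: locally_finite_group_def)
    show "free_retract R (supported_on (generate G Y)) I J"
    proof (rule free_retractI[OF _ _ ab])
      fix i j assume ij: "i \<in> I" "j \<in> J"
      show "a i j \<in> supported_on (generate G Y)"
        using ij a by (intro ms) (auto simp: Y_def)
      show "b j i \<in> supported_on (generate G Y)"
        using ij b by (intro ms) (auto simp: Y_def)
    qed
  qed
qed


section \<open>Comparison with the base ring\<close>

text \<open>If unbounded generating number fails for \<open>R\<close>, then it fails for the base ring.\<close>

lemma free_retract_over_base:
  assumes proj: "projective_grading R G A" and lf: "locally_finite_group G"
    and fr: "free_retract R (carrier R) {..<Suc n} {..<n}"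
  shows "\<exists>m. free_retract R (A \<one>\<^bsub>G\<^esub>) {..<Suc m} {..<m}"
proof -
  let ?T = "A \<one>\<^bsub>G\<^esub>" and ?p = "\<lambda>x. components x \<one>\<^bsub>G\<^esub>"
  obtain H where H: "subgroup H G" "finite H" and frH: "free_retract R (supported_on H) {..<Suc n} {..<n}"
    using free_retract_in_supported_on[OF lf finite_lessThan finite_lessThan fr] by blast
  have HG: "H \<subseteq> carrier G" using H by (simp add: subgroup.subset)
  note S = subring_supported_on[OF H]
  note p = components_mem[OF _ G.one_closed]
  have padd: "?p (x \<oplus>\<^bsub>R\<^esub> y) = ?p x \<oplus>\<^bsub>R\<^esub> ?p y" if "x \<in> carrier R" "y \<in> carrier R" for x y
    using that by (simp add: components_add)
  have p1: "?p \<one>\<^bsub>R\<^esub> = \<one>\<^bsub>R\<^esub>"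
    by (simp add: components_homogeneous[OF G.one_closed one_in_base])
  have sub: "A g \<subseteq> carrier R" if "g \<in> carrier G" for g
    using component_carrier that by blast
  from proj consider
    (right) "\<And>g. g \<in> carrier G \<Longrightarrow> fin_gen_module (base_ring R G A) (right_mult_module R (A g))"
  | (left) "\<And>g. g \<in> carrier G \<Longrightarrow>
      fin_gen_module (opposite_ring (base_ring R G A)) (left_mult_module R (A g))"
    unfolding projective_grading_def by blast
  then show ?thesis
  proof cases
    case right
    have "\<exists>X. finite X \<and> X \<subseteq> A g \<and> A g \<subseteq> right_span R ?T X" if "g \<in> H" for g
    proof -
      have g: "g \<in> carrier G" using that HG by blast
      show ?thesis
        using R.right_span_of_fin_gen_module[OF base_subring sub[OF g]]
          right_component_module[OF g] right[OF g] unfolding base_ring_def by metis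
    qed
    then obtain X where "finite X" "X \<subseteq> carrier R" "supported_on H \<subseteq> right_span R ?T X"
      using supported_on_in_right_span[OF R.ring_axioms refl refl base_subring H(2) HG] by metis
    then show ?thesis
      using p padd p1 components_mult_right
      by (intro R.free_retract_descends[OF S base_subring, of ?p, OF _ _ _ _ _ _ _ frH]) auto
  next
    case left
    let ?Q = "opposite_ring R"
    interpret Q: ring ?Q by (rule ring_opposite_ring[OF R.ring_axioms])
    have Q: "carrier ?Q = carrier R" "add ?Q = add R" "\<one>\<^bsub>?Q\<^esub> = \<one>\<^bsub>R\<^esub>" "\<And>x y. x \<otimes>\<^bsub>?Q\<^esub> y = y \<otimes>\<^bsub>R\<^esub> x"
      by (simp_all add: opposite_ring_def)
    note TQ = subring_opposite_ring[OF R.ring_axioms base_subring]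
    note SQ = subring_opposite_ring[OF R.ring_axioms S]
    have "\<exists>X. finite X \<and> X \<subseteq> A g \<and> A g \<subseteq> right_span ?Q ?T X" if "g \<in> H" for g
    proof -
      have g: "g \<in> carrier G" using that HG by blast
      have "A g \<subseteq> carrier ?Q" using sub[OF g] Q by simp
      then show ?thesis
        using Q.right_span_of_fin_gen_module[OF TQ]
          left_component_module[OF g] left[OF g]
        unfolding base_ring_def left_mult_module_eq opposite_ring_carrier_update by metis
    qed
    then obtain X where "finite X" "X \<subseteq> carrier R" "supported_on H \<subseteq> right_span ?Q ?T X"
      using supported_on_in_right_span[OF Q.ring_axioms Q(1) finsum_opposite_ring TQ H(2) HG] by metis
    moreover have "free_retract ?Q (supported_on H) {..<Suc n} {..<n}"
      using frH by (simp add: free_retract_opposite)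
    ultimately have "\<exists>m. free_retract ?Q ?T {..<Suc m} {..<m}"
      using p padd p1 components_mult_left
      by (intro Q.free_retract_descends[OF SQ TQ, of ?p]) (auto simp: Q)
    then show ?thesis by (simp add: free_retract_opposite)
  qed
qed

end

theorem theoremC:
  fixes R :: "('a, 'm) ring_scheme" and G :: "('g, 'k) monoid_scheme" and A :: "'g \<Rightarrow> 'a set"
  assumes "graded_ring R G A"
    and "projective_grading R G A"
    and "locally_finite_group G"
  shows "UGN R \<longleftrightarrow> UGN (base_ring R G A)"
proof -
  interpret graded_ring R G A by fact
  have "(\<exists>n. free_retract R (carrier R) {..<Suc n} {..<n}) \<longleftrightarrow>
      (\<exists>n. free_retract R (A \<one>\<^bsub>G\<^esub>) {..<Suc n} {..<n})"
    using free_retract_over_base[OF assms(2,3)] free_retract_mono[OF _ subringE(1)[OF base_subring]] by metis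
  then show ?thesis
    unfolding base_ring_def using R.UGN_iff R.UGN_subring_iff[OF base_subring] by simp
qed

end
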